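(* Let $k \ge 12$ be an integer with $k \equiv 0 \pmod 4$ and $\ell = \lfloor k/12 \rfloor$. Then the set $S$ is a bounded convex polytope in $\mathbb{R}^{\ell}$ which is finite; in particular, there is a finite set $A$ of positive integers such that $S = \bigcap_{n \in A} S_{n}$. Consequently, a form $f = 1+\sum_{n\ge1}a(n)q^n \in M_k$ has all Fourier coefficients nonnegative if and only if $a(n)\ge 0$ for all $n \in A$, and $A(k) \leq \max A$.
   Context: $M_k$ is the space of holomorphic modular forms of weight $k$ for $\mathrm{SL}_2(\mathbb{Z})$; it has dimension $\ell+1$. For $0\le r\le \ell$, $F_{k,r}=\sum_{n\ge0} c_r(n)q^n$ is the unique form in $M_k$ with Fourier expansion $q^r + O(q^{\ell+1})$. For each positive integer $n$, $S_n \subseteq \mathbb{R}^\ell$ is the closed half-space of $(a(1),\dots,a(\ell))$ with $c_0(n) + \sum_{r=1}^{\ell} a(r)c_r(n) \ge 0$, i.e. the coefficient of $q^n$ in $F_{k,0}+\sum_{r=1}^\ell a(r)F_{k,r}$ is nonnegative, and $S = \bigcap_{n\ge1} S_n$ is the set of $(a(1),\dots,a(\ell))$ for which the form $1+a(1)q+\dots+a(\ell)q^\ell+\dots\in M_k$ has no negative Fourier coefficients. A convex polytope is an intersection of closed half-spaces; it is bounded if contained in a ball of finite radius and finite if it is the intersection of finitely many closed half-spaces. For $f\in M_k$ with real coefficients $a(n)$, $\mathcal{N}(f)$ is the least $r\ge0$ with $a(r)<0$ (or $\infty$ if none), and $A(k)=\sup\{\mathcal{N}(f): f\in M_k,\ \mathcal{N}(f)<\infty\}$.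 *)

theory Defs
  imports Complex_Main "HOL-Library.Extended_Nat"
begin

text \<open>A holomorphic modular form of weight k for SL2(Z) is identified with its
q-expansion c (c n = coefficient of q^n, q = exp(2 pi i z)). The q-series must converge
on the whole upper half plane (this gives holomorphy, 1-periodicity and holomorphy at
the cusp) and the function must satisfy f(-1/z) = z^k f(z).\<close>

definition qexp :: "(nat \<Rightarrow> complex) \<Rightarrow> complex \<Rightarrow> complex" where
  "qexp c z = (\<Sum>n. c n * exp (2 * of_real pi * \<i> * of_nat n * z))"

definition modform :: "nat \<Rightarrow> (nat \<Rightarrow> complex) set" where
  "modform k = {c. (\<forall>z. Im z > 0 \<longrightarrow>
                      summable (\<lambda>n. c n * exp (2 * of_real pi * \<i> * of_nat n * z))) \<and>
                    (\<forall>z. Im z > 0 \<longrightarrow> qexp c (- 1 / z) = z ^ k * qexp c z)}"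

definition modformR :: "nat \<Rightarrow> (nat \<Rightarrow> real) set" where
  "modformR k = {c. (\<lambda>n. complex_of_real (c n)) \<in> modform k}"

definition Fkr :: "nat \<Rightarrow> nat \<Rightarrow> (nat \<Rightarrow> real)" where
  "Fkr k r = (THE c. c \<in> modformR k \<and> (\<forall>j \<le> k div 12. c j = (if j = r then 1 else 0)))"

text \<open>R^l represented as functions nat => real supported on {1..l}.\<close>
definition Rl :: "nat \<Rightarrow> (nat \<Rightarrow> real) set" where
  "Rl l = {a. \<forall>r. (r = 0 \<or> r > l) \<longrightarrow> a r = 0}"

definition Sn :: "nat \<Rightarrow> nat \<Rightarrow> (nat \<Rightarrow> real) set" where
  "Sn k n = {a \<in> Rl (k div 12).
              Fkr k 0 n + (\<Sum>r = 1..k div 12. a r * Fkr k r n) \<ge> 0}"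

definition Sset :: "nat \<Rightarrow> (nat \<Rightarrow> real) set" where
  "Sset k = Rl (k div 12) \<inter> (\<Inter>n \<in> {1..}. Sn k n)"

definition Nf :: "(nat \<Rightarrow> real) \<Rightarrow> enat" where
  "Nf c = (if \<exists>r. c r < 0 then enat (LEAST r. c r < 0) else \<infinity>)"

definition Ak :: "nat \<Rightarrow> enat" where
  "Ak k = Sup {Nf c | c. c \<in> modformR k \<and> Nf c \<noteq> \<infinity>}"

end

theory Submission
  imports Defs "HOL-Complex_Analysis.Complex_Analysis"
begin

text \<open>Write \<open>k = 4m\<close>. Two forms carry the whole argument: the Eisenstein series \<open>E4\<close>, obtained from the
  Lipschitz formula, and \<open>\<Delta>\<close>, defined as \<open>q exp(-24 \<Sum> \<sigma>(n) q^n / n)\<close>, whose logarithmic derivative is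
  \<open>E2\<close>; the transformation of \<open>E2\<close> comes from comparing the two Eisenstein summation orders. The
  products \<open>E4^(m - 3j) \<Delta>^j\<close> give forms \<open>q^j + O(q^(j+1))\<close> in \<open>M_k\<close>, and a form vanishing to order
  greater than \<open>k / 12\<close> is 0, because \<open>f^3 / \<Delta>^m\<close> is a bounded function of weight 0 that vanishes at the cusp.

  A nonzero cusp form has a negative coefficient: with nonnegative coefficients, \<open>f(it)\<close> could not
  tend to 0 as \<open>t \<rightarrow> 0\<close>. By compactness of the unit sphere, finitely many coefficients detect this,
  with a uniform negative margin, so already finitely many of the half-spaces cut out a bounded set.
  On a bounded set all coefficients of large index are positive, since those of \<open>E4^m\<close> grow at least
  like \<open>n^(3m)\<close> whereas cusp forms satisfy the Hecke bound \<open>O(n^(2m))\<close>.\<close>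

section \<open>The nome and the Lipschitz formula\<close>

text \<open>Divisibility of the weight by 4 shapes the proof: powers of E4 fill whatever weight a
  power of \<open>Delta\<close> leaves over, so E6 never enters, and the cube of a form of weight 4
  m has the weight of the m-th power of \<open>Delta\<close>. Exact constants are avoided: the
  classical 240 in E4 survives only as some \<kappa> > 0. The growth comparison is deliberately
  crude: the coefficients of E4^m have true order n^(4m-1), but n^(3m) follows from a single
  convolution term and already beats the cusp forms. The analytic obstacle is weight 2, where the
  lattice series is not absolutely convergent and rearranging it costs a correction. Bounding A(k)
  asks for more than the polytope: forms with constant term 0, and forms with an arbitrary positive
  constant term, must be tested by the same finite set of indices. The uniform margin settles the
  former, scaling the latter.\<close>

definition nome :: "complex \<Rightarrow> complex" where
  "nome z = exp (2 * of_real pi * \<i> * z)"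

lemma norm_nome: "norm (nome z) = exp (- 2 * pi * Im z)"
  by (simp add: nome_def)

lemma norm_nome_less_1: "Im z > 0 \<Longrightarrow> norm (nome z) < 1"
  by (simp add: norm_nome)

lemma nome_nonzero [simp]: "nome z \<noteq> 0"
  by (simp add: nome_def)

lemma nome_eqE:
  assumes "norm q < 1" "q \<noteq> 0"
  obtains z where "Im z > 0" "nome z = q"
proof
  have "2 * of_real pi * \<i> * (Ln q / (2 * of_real pi * \<i>)) = Ln q"
    by simp
  then show *: "nome (Ln q / (2 * of_real pi * \<i>)) = q"
    using assms by (simp add: nome_def)
  have "exp (- 2 * pi * Im (Ln q / (2 * of_real pi * \<i>))) < 1"
    using norm_nome[of "Ln q / (2 * of_real pi * \<i>)"] * assms by simp
  then show "Im (Ln q / (2 * of_real pi * \<i>)) > 0"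
    by (simp add: zero_less_mult_iff)
qed

lemma nome_of_nat_mult: "nome (of_nat n * z) = nome z ^ n"
  by (simp add: nome_def exp_of_nat_mult [symmetric] algebra_simps)

lemma nome_of_int [simp]: "nome (of_int n) = 1"
  by (auto simp: nome_def exp_eq_1)

lemma nome_add: "nome (w + z) = nome w * nome z"
  by (simp add: nome_def exp_add algebra_simps)

lemma nome_add_1 [simp]: "nome (z + 1) = nome z"
  using nome_of_int[of 1] by (simp add: nome_add)

lemma Im_minus_inverse: "Im (- 1 / z) = Im z / (cmod z)\<^sup>2"
  by (simp add: Im_divide cmod_power2)

lemma Im_minus_inverse_pos: "Im z > 0 \<Longrightarrow> Im (- 1 / z) > 0"
  unfolding Im_minus_inverse by (intro divide_pos_pos) auto

text \<open>In the variable q, differentiation in z is 2 pi i times the Euler operator q d/dq, here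
  \<open>fps_X * fps_deriv\<close>. Derivatives of q-series therefore remain q-series.\<close>

lemma has_field_derivative_eval_fps_nome:
  assumes "fps_conv_radius F \<ge> 1" "Im z > 0"
  shows   "((\<lambda>z. eval_fps F (nome z)) has_field_derivative
             2 * of_real pi * \<i> * eval_fps (fps_X * fps_deriv F) (nome z)) (at z)"
proof -
  have less: "ereal (norm (nome z)) < fps_conv_radius F"
    using assms norm_nome_less_1[of z] by (metis ereal_less(3) less_le_trans one_ereal_def)
  have less': "ereal (norm (nome z)) < fps_conv_radius (fps_deriv F)"
    using less fps_conv_radius_deriv[of F] by (rule less_le_trans)
  have "((\<lambda>z. eval_fps F (nome z)) has_field_derivative
          eval_fps (fps_deriv F) (nome z) * (nome z * (2 * of_real pi * \<i>))) (at z)"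
    unfolding nome_def
    by (rule DERIV_chain2[OF has_field_derivative_eval_fps])
       (use less in \<open>auto simp: nome_def intro!: derivative_eq_intros\<close>)
  also have "eval_fps (fps_X * fps_deriv F) (nome z) = nome z * eval_fps (fps_deriv F) (nome z)"
    using less' by (subst eval_fps_mult) auto
  hence "eval_fps (fps_deriv F) (nome z) * (nome z * (2 * of_real pi * \<i>)) =
     2 * of_real pi * \<i> * eval_fps (fps_X * fps_deriv F) (nome z)" by simp
  finally show ?thesis .
qed

text \<open>The polylogarithm series of order -j. Since \<open>0 ^ 0 = 1\<close>, the constant term
  is 1 for j = 0 but 0 for j > 0; the latter lets the Lambert sums below converge.\<close>

definition power_fps :: "nat \<Rightarrow> complex fps" where
  "power_fps j = Abs_fps (\<lambda>n. of_nat n ^ j)"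

lemma power_fps_Suc: "power_fps (Suc j) = fps_X * fps_deriv (power_fps j)"
proof (rule fps_ext)
  fix n show "fps_nth (power_fps (Suc j)) n = fps_nth (fps_X * fps_deriv (power_fps j)) n"
    by (cases n) (simp_all add: power_fps_def)
qed

lemma fps_conv_radius_power_fps: "fps_conv_radius (power_fps j) \<ge> 1"
proof (induction j)
  case 0
  have "conv_radius (\<lambda>n. 1 :: complex) \<ge> 1"
  proof (rule conv_radius_geI_ex)
    fix r :: real assume "r > 0" "ereal r < 1"
    then show "\<exists>z. norm z = r \<and> summable (\<lambda>n. 1 * z ^ n :: complex)"
      by (intro exI[of _ "of_real r"]) (auto simp: one_ereal_def)
  qed
  then show ?case by (simp add: fps_conv_radius_def power_fps_def)
next
  case (Suc j)
  show ?case unfolding power_fps_Suc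
    by (rule order_trans[OF _ fps_conv_radius_mult])
       (use Suc fps_conv_radius_deriv[of "power_fps j"] in auto)
qed

lemma eval_power_fps_0: "norm q < 1 \<Longrightarrow> eval_fps (power_fps 0) q = 1 / (1 - q)"
  by (simp add: eval_fps_def power_fps_def suminf_geometric)

section \<open>Cotangent and polygamma reflection\<close>

lemma not_Ints_Im_pos: "Im z > 0 \<Longrightarrow> z \<notin> \<int>"
  by (auto elim!: Ints_cases)

lemma one_minus_not_Ints: "z \<notin> \<int> \<Longrightarrow> 1 - z \<notin> \<int>" for z :: complex
  using Ints_diff[OF Ints_1, of "1 - z"] by auto

text \<open>Logarithmic derivative of the reflection formula, computed with the entire function
  \<open>rGamma\<close>: the product rule and the closed form sin (pi z) / pi give two expressions
  for one derivative.\<close>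

lemma Digamma_reflection:
  fixes z :: complex
  assumes "z \<notin> \<int>"
  shows "Digamma (1 - z) - Digamma z = of_real pi * cot (of_real pi * z)"
proof -
  have z: "z \<notin> \<int>\<^sub>\<le>\<^sub>0" "1 - z \<notin> \<int>\<^sub>\<le>\<^sub>0"
    using assms one_minus_not_Ints[OF assms] nonpos_Ints_subset_Ints by blast+
  have eq: "(\<lambda>z. rGamma z * rGamma (1 - z)) = (\<lambda>z. sin (of_real pi * z) / of_real pi :: complex)"
    using rGamma_reflection_complex by blast
  have "((\<lambda>z. rGamma z * rGamma (1 - z)) has_field_derivative
          rGamma z * rGamma (1 - z) * (Digamma (1 - z) - Digamma z)) (at z)"
    using z by (auto intro!: derivative_eq_intros simp: algebra_simps)
  moreover have "((\<lambda>z. rGamma z * rGamma (1 - z)) has_field_derivative cos (of_real pi * z)) (at z)"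
    unfolding eq by (auto intro!: derivative_eq_intros)
  ultimately have "rGamma z * rGamma (1 - z) * (Digamma (1 - z) - Digamma z) = cos (of_real pi * z)"
    by (rule DERIV_unique)
  moreover have "sin (of_real pi * z) \<noteq> 0"
    using z by (metis (no_types, lifting) eq divide_eq_0_iff mult_eq_0_iff rGamma_eq_zero_iff)
  ultimately show ?thesis
    by (simp add: fun_cong[OF eq, of z] cot_def field_simps)
qed

lemma pi_cot_conv_nome:
  assumes "Im z > 0"
  shows "of_real pi * cot (of_real pi * z) =
           of_real pi * \<i> - 2 * of_real pi * \<i> * eval_fps (power_fps 0) (nome z)"
proof -
  have q: "norm (nome z) < 1" using norm_nome_less_1[OF assms] .
  hence ne: "nome z \<noteq> 1" by auto
  define e where "e = exp (\<i> * (of_real pi * z))"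
  have e: "e \<noteq> 0" "nome z = e\<^sup>2" "exp (- (\<i> * (of_real pi * z))) = 1 / e"
    by (simp_all add: e_def nome_def exp_double[symmetric] exp_minus field_simps)
  have ne': "e\<^sup>2 \<noteq> 1" using ne e by simp
  have "cot (of_real pi * z) = ((e + 1/e) / 2) / ((e - 1/e) / (2 * \<i>))"
    unfolding cot_def sin_exp_eq cos_exp_eq e(3) e_def[symmetric] ..
  also have "\<dots> = \<i> * (e\<^sup>2 + 1) / (e\<^sup>2 - 1)"
    using e(1) ne' by (simp add: divide_simps power2_eq_square)
  also have "\<dots> = \<i> - 2 * \<i> / (1 - e\<^sup>2)"
    using ne' by (simp add: divide_simps) (simp add: algebra_simps)
  finally have cot: "cot (of_real pi * z) = \<i> - 2 * \<i> / (1 - e\<^sup>2)" .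
  show ?thesis
    unfolding cot e(2)[symmetric] eval_power_fps_0[OF q] by (simp add: algebra_simps)
qed

lemma DERIV_open_cong:
  assumes "(f has_field_derivative D) (at x)" "open A" "x \<in> A" "\<And>y. y \<in> A \<Longrightarrow> f y = g y"
  shows   "(g has_field_derivative D) (at x)"
  using has_field_derivative_transform_within_open[OF assms] .

text \<open>Repeated differentiation of the Digamma case. Each step turns \<open>power_fps j\<close>
  into 2 pi i times \<open>power_fps (Suc j)\<close>, and the additive constant pi i survives only
  at j = 0.\<close>

lemma Polygamma_reflection:
  fixes z :: complex
  assumes "Im z > 0"
  shows "(-1) ^ j * Polygamma j (1 - z) - Polygamma j z =
           (if j = 0 then of_real pi * \<i> else 0)
             - (2 * of_real pi * \<i>) ^ Suc j * eval_fps (power_fps j) (nome z)"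
  using assms
proof (induction j arbitrary: z)
  case 0
  then show ?case
    using Digamma_reflection[of z] pi_cot_conv_nome[of z] not_Ints_Im_pos[of z] by simp
next
  case (Suc j)
  have ni: "z \<notin> \<int>" using not_Ints_Im_pos Suc by blast
  have z: "z \<notin> \<int>\<^sub>\<le>\<^sub>0" "1 - z \<notin> \<int>\<^sub>\<le>\<^sub>0"
    using ni one_minus_not_Ints[OF ni] nonpos_Ints_subset_Ints by blast+
  have "((\<lambda>z. (-1) ^ j * Polygamma j (1 - z) - Polygamma j z) has_field_derivative
          (-1) ^ Suc j * Polygamma (Suc j) (1 - z) - Polygamma (Suc j) z) (at z)"
    using z by (auto intro!: derivative_eq_intros)
  moreover have "((\<lambda>z. (if j = 0 then of_real pi * \<i> else 0)
             - (2 * of_real pi * \<i>) ^ Suc j * eval_fps (power_fps j) (nome z)) has_field_derivative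
          (0 - (2 * of_real pi * \<i>) ^ Suc j * (2 * of_real pi * \<i> *
             eval_fps (fps_X * fps_deriv (power_fps j)) (nome z)))) (at z)"
    by (intro DERIV_diff DERIV_const DERIV_cmult has_field_derivative_eval_fps_nome
              fps_conv_radius_power_fps Suc.prems)
  then have "((\<lambda>z. (-1) ^ j * Polygamma j (1 - z) - Polygamma j z) has_field_derivative
          (0 - (2 * of_real pi * \<i>) ^ Suc j * (2 * of_real pi * \<i> *
             eval_fps (fps_X * fps_deriv (power_fps j)) (nome z)))) (at z)"
    by (rule DERIV_open_cong[OF _ open_halfspace_Im_gt[of 0]]) (use Suc in auto)
  ultimately have "(-1) ^ Suc j * Polygamma (Suc j) (1 - z) - Polygamma (Suc j) z =
     0 - (2 * of_real pi * \<i>) ^ Suc j * (2 * of_real pi * \<i> *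
             eval_fps (fps_X * fps_deriv (power_fps j)) (nome z))"
    by (rule DERIV_unique)
  then show ?case unfolding power_fps_Suc by (simp add: algebra_simps)
qed

section \<open>Absolute convergence of lattice sums\<close>

lemma lattice_lower_bound:
  assumes "Im z > 0"
  obtains c where "c > 0" "\<And>x y. norm (of_real x * z + of_real y) \<ge> c * (\<bar>x\<bar> + \<bar>y\<bar>)"
proof
  \<comment> \<open>K adds up two estimates relative to the norm of the lattice point: its imaginary
    part x Im z controls |x|, and subtracting x z then controls |y|.\<close>
  define K where "K = 1 / Im z + 1 + norm z / Im z"
  have K: "K > 0" using assms by (auto simp: K_def intro!: add_pos_nonneg)
  then show "1 / K > 0" by simp
  fix x y :: real
  let ?w = "of_real x * z + of_real y"
  have "\<bar>x\<bar> * Im z \<le> norm ?w"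
    using abs_Im_le_cmod[of ?w] assms by (simp add: abs_mult)
  hence 1: "\<bar>x\<bar> \<le> norm ?w / Im z" using assms by (simp add: field_simps)
  have "\<bar>y\<bar> = norm (?w - of_real x * z)" by simp
  also have "\<dots> \<le> norm ?w + \<bar>x\<bar> * norm z"
    by (metis norm_mult norm_of_real norm_triangle_ineq4)
  also have "\<dots> \<le> norm ?w + norm ?w / Im z * norm z"
    using 1 by (intro add_left_mono mult_right_mono) auto
  finally have "\<bar>x\<bar> + \<bar>y\<bar> \<le> norm ?w * K" using 1 by (simp add: K_def algebra_simps)
  then show "norm ?w \<ge> 1 / K * (\<bar>x\<bar> + \<bar>y\<bar>)" using K by (simp add: field_simps)
qed

lemma summable_on_int_even:
  fixes f :: "int \<Rightarrow> real"
  assumes "\<And>n. f (- n) = f n" "summable (\<lambda>n. f (int n))" "\<And>n. f n \<ge> 0"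
  shows "f summable_on UNIV"
proof -
  have 1: "(\<lambda>n. f (int n)) summable_on UNIV"
    using assms by (intro summable_nonneg_imp_summable_on) auto
  have "f summable_on range int"
    using 1 by (subst summable_on_reindex) (auto simp: o_def)
  moreover have "f summable_on range (\<lambda>n. - int n)"
    using 1 assms(1) by (subst summable_on_reindex) (auto simp: o_def inj_on_def)
  moreover have "UNIV = range int \<union> range (\<lambda>n. - int n)"
    by (auto simp: image_iff) (metis int_cases2)
  ultimately show ?thesis by (metis summable_on_union)
qed

text \<open>The exponent 3/2 exceeds 1, so the weight is summable over the integers, while a product
  of two weights has total degree -3 and so matches the cube of |m| + |n|.\<close>

definition lattice_weight :: "int \<Rightarrow> real" where
  "lattice_weight n = (1 + \<bar>of_int n\<bar>) powr (- 3 / 2)"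

lemma lattice_weight_summable: "lattice_weight summable_on UNIV"
proof (rule summable_on_int_even)
  have "summable (\<lambda>n. real (n + 1) powr (- 3 / 2))"
    by (subst summable_iff_shift) (simp add: summable_real_powr_iff)
  then show "summable (\<lambda>n. lattice_weight (int n))"
    by (simp add: lattice_weight_def add_ac)
qed (auto simp: lattice_weight_def)

lemma lattice_weight_product_summable:
  "(\<lambda>(m, n). lattice_weight m * lattice_weight n) summable_on UNIV"
proof -
  have "(\<lambda>(m, n). lattice_weight m * lattice_weight n) summable_on (UNIV \<times> UNIV)"
  proof (rule summable_on_SigmaI)
    fix m show "((\<lambda>n. case (m, n) of (m, n) \<Rightarrow> lattice_weight m * lattice_weight n) has_sum
                  (lattice_weight m * infsum lattice_weight UNIV)) UNIV"
      using has_sum_cmult_right[OF has_sum_infsum[OF lattice_weight_summable]] by simp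
  next
    show "(\<lambda>m. lattice_weight m * infsum lattice_weight UNIV) summable_on UNIV"
      by (intro summable_on_cmult_left lattice_weight_summable)
  qed (auto simp: lattice_weight_def)
  then show ?thesis by simp
qed

lemma inverse_cube_le_lattice_weight:
  assumes "(m, n) \<noteq> (0, 0)"
  shows "1 / (\<bar>of_int m\<bar> + \<bar>of_int n\<bar>) ^ 3 \<le> 8 * (lattice_weight m * lattice_weight n)"
proof -
  define s where "s = \<bar>real_of_int m\<bar> + \<bar>of_int n\<bar>"
  have s: "s \<ge> 1"
  proof -
    have "\<bar>m\<bar> + \<bar>n\<bar> \<ge> 1" using assms by auto
    then show ?thesis unfolding s_def by (metis of_int_1_le_iff of_int_abs of_int_add)
  qed
  \<comment> \<open>Since s >= 1, both 1 + |m| and 1 + |n| are at most 2 s; the factor 8 is 2 ^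
    3.\<close>
  have "(1 + \<bar>of_int m\<bar>) powr (3 / 2) * (1 + \<bar>of_int n\<bar>) powr (3/2)
          \<le> (2 * s) powr (3/2) * (2 * s) powr (3/2)"
    using s by (intro mult_mono powr_mono2) (auto simp: s_def)
  also have "\<dots> = (2 * s) powr 3"
    by (simp add: powr_add [symmetric])
  also have "\<dots> = 8 * s ^ 3"
    using s powr_realpow[of "2 * s" 3] by (simp add: power_mult_distrib)
  finally have "1 / (8 * s ^ 3) \<le> 1 / ((1 + \<bar>of_int m\<bar>) powr (3 / 2) * (1 + \<bar>of_int n\<bar>) powr (3/2))"
    by (intro divide_left_mono) (use s in auto)
  also have "\<dots> = lattice_weight m * lattice_weight n"
    by (simp add: lattice_weight_def powr_minus_divide)
  finally show ?thesis unfolding s_def[symmetric] by simp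
qed

text \<open>Exponent 3 is enough in two dimensions. Exponent 2 is not, which is why weight 2 is
  treated separately.\<close>

lemma lattice_power_summable:
  assumes "Im z > 0" "j \<ge> 3"
  shows "(\<lambda>(m, n). 1 / (of_int m * z + of_int n) ^ j) summable_on - {(0, 0)}"
proof -
  obtain c where c: "c > 0" "\<And>x y. norm (of_real x * z + of_real y) \<ge> c * (\<bar>x\<bar> + \<bar>y\<bar>)"
    using lattice_lower_bound[OF assms(1)] by blast
  have "(\<lambda>x. norm (case x of (m, n) \<Rightarrow> 1 / (of_int m * z + of_int n) ^ j)) summable_on - {(0, 0)}"
  proof (rule Infinite_Sum.abs_summable_on_comparison_test')
    show "(\<lambda>x. (1 / c ^ j) * 8 * (case x of (m, n) \<Rightarrow> lattice_weight m * lattice_weight n)) summable_on - {(0, 0)}"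
      by (intro summable_on_cmult_right summable_on_subset[OF lattice_weight_product_summable]) auto
  next
    fix x :: "int \<times> int" assume x: "x \<in> - {(0, 0)}"
    obtain m n where mn: "x = (m, n)" by (cases x)
    define s where "s = \<bar>real_of_int m\<bar> + \<bar>of_int n\<bar>"
    have s: "s \<ge> 1"
    proof -
      have "\<bar>m\<bar> + \<bar>n\<bar> \<ge> 1" using x mn by auto
      then show ?thesis unfolding s_def by (metis of_int_1_le_iff of_int_abs of_int_add)
    qed
    have "c * s \<le> norm (of_int m * z + of_int n)"
      using c(2)[of "of_int m" "of_int n"] by (simp add: s_def)
    hence "(c * s) ^ j \<le> norm (of_int m * z + of_int n) ^ j"
      using c s by (intro power_mono) auto
    moreover have cs: "c * s > 0" using c s by simp
    moreover have "norm (of_int m * z + of_int n) > 0"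
      using cs \<open>c * s \<le> _\<close> by linarith
    ultimately have "1 / norm (of_int m * z + of_int n) ^ j \<le> 1 / (c * s) ^ j"
      by (intro frac_le zero_less_power) simp_all
    also have "\<dots> \<le> 1 / c ^ j * (1 / s ^ 3)"
      using c s assms by (auto simp: power_mult_distrib intro!: divide_left_mono mult_left_mono power_increasing)
    also have "\<dots> \<le> 1 / c ^ j * (8 * (lattice_weight m * lattice_weight n))"
      unfolding s_def using c x mn
      by (intro mult_left_mono inverse_cube_le_lattice_weight) auto
    finally show "norm (case x of (m, n) \<Rightarrow> 1 / (of_int m * z + of_int n) ^ j) \<le>
        (1 / c ^ j) * 8 * (case x of (m, n) \<Rightarrow> lattice_weight m * lattice_weight n)"
      by (simp add: mn norm_divide norm_power)
  qed
  then show ?thesis by (rule abs_summable_summable)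
qed

section \<open>Bilateral sums and the Lipschitz formula\<close>

lemma shifted_power_norm_summable:
  fixes z :: complex
  assumes "z \<notin> \<int>" "j \<ge> 2"
  shows "summable (\<lambda>k. norm (inverse ((z + of_nat k) ^ j)))"
proof (rule summable_comparison_test_ev)
  \<comment> \<open>Beyond N the index k is at least 2 |z|, so z + k has norm at least k /
    2.\<close>
  define N where "N = nat \<lceil>2 * norm z\<rceil> + 1"
  have "norm (norm (inverse ((z + of_nat k) ^ j))) \<le> 4 * (1 / real k ^ 2) * 2 ^ j" if k: "k \<ge> N + 2" for k
  proof -
    have k2: "real k \<ge> 2 * norm z" "real k \<ge> 2" using k unfolding N_def by linarith+
    have "real k - norm z \<le> norm (z + of_nat k)"
      by (metis add.commute norm_diff_ineq norm_of_nat)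
    with k2 have h: "real k / 2 \<le> norm (z + of_nat k)" by simp
    hence "(real k / 2) ^ j \<le> norm (z + of_nat k) ^ j" using k2 by (intro power_mono) auto
    moreover have "(real k / 2) ^ 2 \<le> (real k / 2) ^ j"
      using k2 assms by (intro power_increasing) auto
    ultimately have "(real k / 2) ^ 2 \<le> norm (z + of_nat k) ^ j" by simp
    hence "inverse (norm (z + of_nat k) ^ j) \<le> inverse ((real k / 2) ^ 2)"
      using k2 by (intro le_imp_inverse_le) auto
    also have "\<dots> = 4 * (1 / real k ^ 2) * 1" by (simp add: power_divide inverse_eq_divide)
    also have "\<dots> \<le> 4 * (1 / real k ^ 2) * 2 ^ j" by (intro mult_left_mono) auto
    finally show ?thesis by (simp add: norm_inverse norm_power)
  qed
  then show "\<forall>\<^sub>F k in sequentially. norm (norm (inverse ((z + of_nat k) ^ j))) \<le> 4 * (1 / real k ^ 2) * 2 ^ j"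
    unfolding eventually_sequentially by blast
  have "summable (\<lambda>k. inverse (real k ^ 2))" by (rule inverse_power_summable) auto
  then show "summable (\<lambda>k. 4 * (1 / real k ^ 2) * 2 ^ j)"
    by (intro summable_mult summable_mult2) (simp add: inverse_eq_divide)
qed

text \<open>Indexing the negative half by -1 - n keeps the halves disjoint and fits the polygamma
  series, because z + (-1 - n) is -(1 - z + n).\<close>

lemma has_sum_int_split:
  fixes f :: "int \<Rightarrow> 'a :: topological_comm_monoid_add"
  assumes "((\<lambda>n. f (int n)) has_sum a) UNIV" "((\<lambda>n. f (- 1 - int n)) has_sum b) UNIV"
  shows "(f has_sum (a + b)) UNIV"
proof -
  have "(f has_sum a) (range int)"
    using assms(1) by (subst has_sum_reindex) (auto simp: o_def)
  moreover have "(f has_sum b) (range (\<lambda>n. - 1 - int n))"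
    using assms(2) by (subst has_sum_reindex) (auto simp: o_def inj_on_def)
  ultimately have "(f has_sum (a + b)) (range int \<union> range (\<lambda>n. - 1 - int n))"
    by (rule has_sum_Un_disjoint) auto
  moreover have "x \<in> range int \<union> range (\<lambda>n. - 1 - int n)" for x
  proof (cases "x \<ge> 0")
    case True then show ?thesis by (auto simp: image_iff intro!: exI[of _ "nat x"])
  next
    case False then show ?thesis by (auto simp: image_iff intro!: exI[of _ "nat (-1-x)"])
  qed
  hence "range int \<union> range (\<lambda>n. - 1 - int n) = UNIV" by blast
  ultimately show ?thesis by simp
qed

text \<open>The two halves of the bilateral sum are polygamma values at z and 1 - z. For odd j the
  exponent \<open>Suc j\<close> is even, so the sign of -(1 - z + n) disappears and the values add
  up as in \<open>Polygamma_reflection\<close>.\<close>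

theorem Lipschitz_formula:
  assumes "Im z > 0" "odd j"
  shows "((\<lambda>n::int. 1 / (z + of_int n) ^ Suc j) has_sum
            (2 * of_real pi * \<i>) ^ Suc j / fact j * eval_fps (power_fps j) (nome z)) UNIV"
proof -
  have j: "j > 0" using assms(2) by (cases j) auto
  have z: "z \<notin> \<int>" "1 - z \<notin> \<int>"
    using not_Ints_Im_pos[OF assms(1)] one_minus_not_Ints by blast+
  hence z0: "z \<noteq> 0" "1 - z \<noteq> 0" by auto
  have *: "((\<lambda>k. inverse ((w + of_nat k) ^ Suc j)) has_sum (Polygamma j w / fact j)) UNIV"
    if "w \<notin> \<int>" for w :: complex
  proof (rule norm_summable_imp_has_sum)
    show "summable (\<lambda>k. norm (inverse ((w + of_nat k) ^ Suc j)))"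
      by (rule shifted_power_norm_summable[OF that]) (use j in auto)
    have "w \<noteq> 0" using that by auto
    from Polygamma_LIMSEQ[OF this j]
    show "(\<lambda>k. inverse ((w + of_nat k) ^ Suc j)) sums (Polygamma j w / fact j)"
      using assms(2) by (simp add: minus_one_power_iff)
  qed
  have "((\<lambda>n::int. 1 / (z + of_int n) ^ Suc j) has_sum
          (Polygamma j z / fact j + Polygamma j (1 - z) / fact j)) UNIV"
  proof (rule has_sum_int_split)
    show "((\<lambda>n. 1 / (z + of_int (int n)) ^ Suc j) has_sum Polygamma j z / fact j) UNIV"
      using *[OF z(1)] by (simp add: inverse_eq_divide)
    have "(z + of_int (- 1 - int k)) ^ Suc j = (1 - z + of_nat k) ^ Suc j" for k
    proof -
      have *: "z + of_int (- 1 - int k) = - (1 - z + of_nat k)" by simp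
      show ?thesis unfolding * by (rule power_minus_even) (use assms(2) in simp)
    qed
    then show "((\<lambda>n. 1 / (z + of_int (- 1 - int n)) ^ Suc j) has_sum Polygamma j (1 - z) / fact j) UNIV"
      using *[OF z(2)] by (simp only: inverse_eq_divide)
  qed
  moreover have "Polygamma j z + Polygamma j (1 - z) = (2 * of_real pi * \<i>) ^ Suc j * eval_fps (power_fps j) (nome z)"
    using Polygamma_reflection[OF assms(1), of j] assms(2) j by (simp add: algebra_simps)
  ultimately show ?thesis by (simp add: add_divide_distrib [symmetric])
qed

section \<open>Lambert series and the weight four Eisenstein series\<close>

text \<open>Every d divides 0, so at n = 0 the index set is infinite and the sum takes its default
  value 0: the generating series has no constant term.\<close>

definition divisor_sum :: "nat \<Rightarrow> nat \<Rightarrow> nat" where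
  "divisor_sum j n = (\<Sum>d | d dvd n. d ^ j)"

lemma divisor_sum_0 [simp]: "divisor_sum j 0 = 0"
  by (simp add: divisor_sum_def)

lemma divisor_sum_ge: "divisor_sum j n \<ge> n ^ j" if "n > 0"
  unfolding divisor_sum_def using that by (intro member_le_sum) auto

definition sigma_fps :: "nat \<Rightarrow> complex fps" where
  "sigma_fps j = Abs_fps (\<lambda>n. of_nat (divisor_sum j n))"

lemma fps_nth_sigma_fps [simp]: "fps_nth (sigma_fps j) n = of_nat (divisor_sum j n)"
  by (simp add: sigma_fps_def)

lemma less_fps_conv_radius:
  assumes "fps_conv_radius F \<ge> 1" "norm q < 1"
  shows "ereal (norm q) < fps_conv_radius F"
  using assms by (metis ereal_less(3) less_le_trans one_ereal_def)

text \<open>One absolutely convergent double series in (k, d), summed by rows or regrouped along n =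
  (k + 1) d. The common value stays anonymous because the convergence radius of
  \<open>sigma_fps\<close> is itself deduced from this lemma.\<close>

lemma Lambert_series_aux:
  assumes q: "norm q < 1" and j: "j > 0"
  obtains L where "((\<lambda>n. of_nat (divisor_sum j n) * q ^ n) has_sum L) UNIV"
    "((\<lambda>k. eval_fps (power_fps j) (q ^ Suc k)) has_sum L) UNIV"
proof -
  define f where "f = (\<lambda>(k, d). of_nat d ^ j * q ^ (Suc k * d))"
  define r where "r = norm q"
  have r: "0 \<le> r" "r < 1" using q by (auto simp: r_def)
  have sd: "(\<lambda>d. real d ^ j * r ^ d) summable_on UNIV"
  proof (rule summable_nonneg_imp_summable_on)
    have "summable (\<lambda>n. norm (fps_nth (power_fps j) n * q ^ n))"
      using less_fps_conv_radius[OF fps_conv_radius_power_fps q, of j]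
      by (intro abs_summable_in_conv_radius) (simp add: fps_conv_radius_def)
    then show "summable (\<lambda>d. real d ^ j * r ^ d)"
      by (simp add: power_fps_def norm_mult norm_power r_def)
  qed (use r in auto)
  have sk: "(\<lambda>k. r ^ k) summable_on UNIV"
    using r by (intro summable_nonneg_imp_summable_on summable_geometric) auto
  have "(\<lambda>x. norm (f x)) summable_on (UNIV \<times> UNIV)"
  proof (rule Infinite_Sum.abs_summable_on_comparison_test')
    show "(\<lambda>(k, d). r ^ k * (real d ^ j * r ^ d)) summable_on (UNIV \<times> UNIV)"
    proof (rule summable_on_SigmaI)
      fix k show "((\<lambda>d. case (k, d) of (k, d) \<Rightarrow> r ^ k * (real d ^ j * r ^ d)) has_sum
                    (r ^ k * infsum (\<lambda>d. real d ^ j * r ^ d) UNIV)) UNIV"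
        using has_sum_cmult_right[OF has_sum_infsum[OF sd]] by simp
    next
      show "(\<lambda>k. r ^ k * infsum (\<lambda>d. real d ^ j * r ^ d) UNIV) summable_on UNIV"
        by (intro summable_on_cmult_left sk)
    qed (use r in auto)
  next
    fix x :: "nat \<times> nat"
    obtain k d where x: "x = (k, d)" by (cases x)
    show "norm (f x) \<le> (case x of (k, d) \<Rightarrow> r ^ k * (real d ^ j * r ^ d))"
    proof (cases d)
      case 0
      then show ?thesis using j by (simp add: f_def x power_0_left)
    next
      case (Suc d')
      \<comment> \<open>For d >= 1, (k + 1) d >= k + d, which bounds the double series by a product
        of two single ones.\<close>
      have "r ^ (Suc k * d) \<le> r ^ (k + d)"
        using r Suc by (intro power_decreasing) auto
      then have "real d ^ j * r ^ (Suc k * d) \<le> real d ^ j * r ^ (k + d)"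
        by (rule mult_left_mono) auto
      then show ?thesis by (simp add: f_def x norm_mult norm_power r_def power_add mult_ac)
    qed
  qed
  then have "f summable_on (UNIV \<times> UNIV)" by (rule abs_summable_summable)
  then obtain L where L: "(f has_sum L) (UNIV \<times> UNIV)" by (auto simp: summable_on_def)
  have "((\<lambda>k. eval_fps (power_fps j) (q ^ Suc k)) has_sum L) UNIV"
  proof (rule has_sum_SigmaD[OF L])
    fix k :: nat
    have qk: "norm (q ^ Suc k) < 1"
      using r power_Suc_le_self[of r k] unfolding norm_power r_def[symmetric] by simp
    have "ereal (norm (q ^ Suc k)) < conv_radius (fps_nth (power_fps j))"
      using less_fps_conv_radius[OF fps_conv_radius_power_fps qk, of j]
      by (simp add: fps_conv_radius_def)
    then have "((\<lambda>d. fps_nth (power_fps j) d * (q ^ Suc k) ^ d) has_sum eval_fps (power_fps j) (q ^ Suc k)) UNIV"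
      unfolding eval_fps_def
      by (intro norm_summable_imp_has_sum abs_summable_in_conv_radius summable_sums summable_in_conv_radius)
    then show "((\<lambda>d. f (k, d)) has_sum eval_fps (power_fps j) (q ^ Suc k)) UNIV"
      unfolding f_def by (simp only: power_fps_def fps_nth_Abs_fps power_mult prod.case)
  qed
  moreover have "((\<lambda>n. of_nat (divisor_sum j n) * q ^ n) has_sum L) UNIV"
  proof -
    \<comment> \<open>The terms with d = 0 vanish because j > 0; the remaining pairs correspond to
      an n >= 1 together with one of its divisors.\<close>
    have L': "(f has_sum L) (UNIV \<times> {1..})"
      using L by (rule has_sum_cong_neutral[THEN iffD1, rotated 3]) (use j in \<open>auto simp: f_def\<close>)
    have "((\<lambda>(n, d). of_nat d ^ j * q ^ n) has_sum L) (Sigma {1..} (\<lambda>n. {d. d dvd n}))"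
      by (rule has_sum_reindex_bij_witness[where i = "\<lambda>(n, d). (n div d - 1, d)" and
            j = "\<lambda>(k, d). (Suc k * d, d)", THEN iffD1, OF _ _ _ _ _ refl L'])
         (auto simp: f_def mult.commute simp del: mult_Suc mult_Suc_right elim!: dvdE)
    then have "((\<lambda>n. of_nat (divisor_sum j n) * q ^ n) has_sum L) {1..}"
    proof (rule has_sum_SigmaD)
      fix n :: nat assume "n \<in> {1..}"
      then have "finite {d. d dvd n}" by (intro finite_divisors_nat) auto
      then show "((\<lambda>d. case (n, d) of (n, d) \<Rightarrow> of_nat d ^ j * q ^ n) has_sum
                   of_nat (divisor_sum j n) * q ^ n) {d. d dvd n}"
        by (intro has_sum_finiteI) (auto simp: divisor_sum_def sum_distrib_right)
    qed
    then show ?thesis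
      by (rule has_sum_cong_neutral[THEN iffD1, rotated 3]) (auto simp: not_le)
  qed
  ultimately show ?thesis using that by blast
qed

lemma fps_conv_radius_sigma_fps: "fps_conv_radius (sigma_fps j) \<ge> 1" if "j > 0"
  unfolding fps_conv_radius_def
proof (rule conv_radius_geI_ex')
  fix r :: real assume r: "r > 0" "ereal r < 1"
  then have "norm (of_real r :: complex) < 1" by (simp add: one_ereal_def)
  from this that obtain L where L: "((\<lambda>n. of_nat (divisor_sum j n) * complex_of_real r ^ n) has_sum L) UNIV"
    by (rule Lambert_series_aux)
  show "summable (\<lambda>n. fps_nth (sigma_fps j) n * complex_of_real r ^ n)"
    unfolding fps_nth_sigma_fps by (rule sums_summable[OF has_sum_imp_sums[OF L]])
qed

lemma Lambert_series:
  assumes "norm q < 1" "j > 0"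
  shows "((\<lambda>k. eval_fps (power_fps j) (q ^ Suc k)) has_sum eval_fps (sigma_fps j) q) UNIV"
proof -
  obtain L where L: "((\<lambda>n. of_nat (divisor_sum j n) * q ^ n) has_sum L) UNIV"
    "((\<lambda>k. eval_fps (power_fps j) (q ^ Suc k)) has_sum L) UNIV"
    using assms by (rule Lambert_series_aux)
  from L(1) have "L = eval_fps (sigma_fps j) q"
    by (auto dest!: has_sum_imp_sums simp: eval_fps_def sums_iff)
  with L(2) show ?thesis by simp
qed

lemma has_sum_even_int:
  fixes f :: "int \<Rightarrow> complex"
  assumes even: "\<And>n. f (- n) = f n"
  shows "(f has_sum (2 * t)) (- {0}) \<longleftrightarrow> ((\<lambda>k. f (int (Suc k))) has_sum t) UNIV"
proof -
  define P N where "P = range (\<lambda>k. int (Suc k))" and "N = range (\<lambda>k. - int (Suc k))"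
  have PN: "- {0} = P \<union> N" "P \<inter> N = {}"
  proof -
    have "x \<in> P \<union> N" if "x \<noteq> 0" for x
    proof (cases "x > 0")
      case True
      then have "x = int (Suc (nat (x - 1)))" by simp
      then show ?thesis unfolding P_def by blast
    next
      case False
      with that have "x = - int (Suc (nat (- x - 1)))" by simp
      then show ?thesis unfolding N_def by blast
    qed
    then show "- {0} = P \<union> N" by (auto simp: P_def N_def)
    show "P \<inter> N = {}" by (auto simp: P_def N_def)
  qed
  have P: "(f has_sum s) P \<longleftrightarrow> ((\<lambda>k. f (int (Suc k))) has_sum s) UNIV" for s
    unfolding P_def by (subst has_sum_reindex) (auto simp: inj_on_def o_def)
  have N: "(f has_sum s) N \<longleftrightarrow> ((\<lambda>k. f (int (Suc k))) has_sum s) UNIV" for s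
    unfolding N_def using even by (subst has_sum_reindex) (auto simp: inj_on_def o_def simp del: of_nat_Suc)
  show ?thesis
  proof
    assume *: "(f has_sum (2 * t)) (- {0})"
    then have "f summable_on - {0}" by (auto simp: summable_on_def)
    then have "f summable_on P" using PN by (auto intro: summable_on_subset)
    then obtain s where s: "(f has_sum s) P" by (auto simp: summable_on_def)
    then have "(f has_sum s) N" using P N by simp
    with s have "(f has_sum (s + s)) (- {0})" unfolding PN(1) by (intro has_sum_Un_disjoint PN(2))
    with * have "2 * t = s + s" using has_sum_unique by blast
    then show "((\<lambda>k. f (int (Suc k))) has_sum t) UNIV" using s P by simp
  next
    assume "((\<lambda>k. f (int (Suc k))) has_sum t) UNIV"
    then have "(f has_sum (t + t)) (- {0})" unfolding PN(1) using P N
      by (intro has_sum_Un_disjoint PN(2)) blast+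
    then show "(f has_sum (2 * t)) (- {0})" by simp
  qed
qed

definition Lipschitz_const :: "nat \<Rightarrow> complex" where
  "Lipschitz_const j = (2 * of_real pi * \<i>) ^ Suc j / fact j"

lemma lattice_row_sum:
  assumes "Im z > 0" "odd j" "m \<noteq> 0"
  shows "((\<lambda>n::int. 1 / (of_int m * z + of_int n) ^ Suc j) has_sum
            Lipschitz_const j * eval_fps (power_fps j) (nome z ^ nat \<bar>m\<bar>)) UNIV"
proof -
  have *: "((\<lambda>n::int. 1 / (of_int l * z + of_int n) ^ Suc j) has_sum
            Lipschitz_const j * eval_fps (power_fps j) (nome z ^ nat l)) UNIV" if "l > 0" for l :: int
  proof -
    have "of_int l = (of_nat (nat l) :: complex)" using that by simp
    then show ?thesis
      using Lipschitz_formula[of "of_int l * z" j] that assms nome_of_nat_mult[of "nat l" z]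
      by (simp add: Lipschitz_const_def zero_less_mult_iff)
  qed
  show ?thesis
  proof (cases "m > 0")
    case True
    then show ?thesis using *[of m] by simp
  next
    case False
    then have m: "- m > 0" using assms by simp
    \<comment> \<open>Reflecting n changes m z + n into the negative of the point with first
      coordinate -m, and the even exponent hides the sign.\<close>
    have pow: "(of_int m * z + of_int (- n)) ^ Suc j = (of_int (- m) * z + of_int n) ^ Suc j" for n
    proof -
      have *: "of_int m * z + of_int (- n) = - (of_int (- m) * z + of_int n)" by simp
      show ?thesis unfolding * by (rule power_minus_even) (use assms(2) in simp)
    qed
    have "((\<lambda>n::int. 1 / (of_int m * z + of_int n) ^ Suc j) has_sum
            Lipschitz_const j * eval_fps (power_fps j) (nome z ^ nat (- m))) UNIV"
      by (rule has_sum_reindex_bij_witness[where i = uminus and j = uminus,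
              THEN iffD1, OF _ _ _ _ _ refl *[OF m]])
         (simp_all only: pow minus_minus UNIV_I)
    then show ?thesis using m by simp
  qed
qed

lemma Lambert_int_has_sum:
  assumes "Im z > 0" "j > 0"
  shows "((\<lambda>m. Lipschitz_const j * eval_fps (power_fps j) (nome z ^ nat \<bar>m\<bar>)) has_sum
           2 * (Lipschitz_const j * eval_fps (sigma_fps j) (nome z))) (- {0})"
  by (subst has_sum_even_int)
     (use has_sum_cmult_right[OF Lambert_series[OF norm_nome_less_1[OF assms(1)] assms(2)]]
        in \<open>simp_all del: power_Suc of_nat_Suc\<close>)

text \<open>The lattice sum of exponent 4 is absolutely convergent, so it may be reindexed by (m, n)
  -> (n, -m), which gives the transformation law, and summed by rows, which gives the
  q-expansion.\<close>

theorem weight_four_Eisenstein: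
  obtains \<kappa> :: real where "\<kappa> > 0"
    "\<And>z. Im z > 0 \<Longrightarrow> 1 + of_real \<kappa> * eval_fps (sigma_fps 3) (nome (- 1 / z)) =
               z ^ 4 * (1 + of_real \<kappa> * eval_fps (sigma_fps 3) (nome z))"
proof -
  define f where "f = (\<lambda>z (m, n). 1 / (of_int m * z + of_int n :: complex) ^ 4)"
  define G where "G = (\<lambda>z. infsum (f z) (- {(0, 0)}))"
  have f_sum: "(f z has_sum G z) (- {(0, 0)})" if "Im z > 0" for z
    unfolding G_def f_def using lattice_power_summable[OF that, of 4] by simp
  have "summable (\<lambda>k. 1 / real (Suc k) ^ 4)"
    using inverse_power_summable[of 4, where 'a = real]
    by (subst summable_Suc_iff) (simp add: inverse_eq_divide)
  then have "(\<lambda>k. 1 / real (Suc k) ^ 4) summable_on UNIV"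
    by (intro summable_nonneg_imp_summable_on) auto
  then obtain s where s: "((\<lambda>k. 1 / real (Suc k) ^ 4) has_sum s) UNIV"
    by (auto simp: summable_on_def)
  have "s \<ge> 1"
    using finite_sum_le_has_sum[OF s, of "{0}"] by simp
  have "((\<lambda>k. of_real (1 / real (Suc k) ^ 4) :: complex) has_sum of_real s) UNIV"
    using s by (rule has_sum_of_real)
  then have zeta: "((\<lambda>n. 1 / of_int n ^ 4) has_sum (2 * of_real s :: complex)) (- {0})"
    by (subst has_sum_even_int) simp_all
  have G: "G z = 2 * of_real s + 2 * (Lipschitz_const 3 * eval_fps (sigma_fps 3) (nome z))"
    if z: "Im z > 0" for z
  proof -
    have split: "- {(0, 0)} = {0} \<times> (- {0}) \<union> (- {0 :: int}) \<times> (UNIV :: int set)" by auto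
    have "f z summable_on (- {0}) \<times> UNIV"
      using f_sum[OF z] unfolding split by (meson has_sum_imp_summable summable_on_subset sup_ge2)
    then obtain R where R: "(f z has_sum R) ((- {0}) \<times> UNIV)" by (auto simp: summable_on_def)
    have "((\<lambda>m. Lipschitz_const 3 * eval_fps (power_fps 3) (nome z ^ nat \<bar>m\<bar>)) has_sum R) (- {0})"
      by (rule has_sum_SigmaD[OF R]) (use lattice_row_sum[OF z, of 3] in \<open>auto simp: f_def\<close>)
    then have R_eq: "R = 2 * (Lipschitz_const 3 * eval_fps (sigma_fps 3) (nome z))"
      by (rule has_sum_unique) (rule Lambert_int_has_sum, use z in auto)
    have "(f z has_sum (2 * of_real s)) ({0} \<times> (- {0}))"
      by (rule has_sum_reindex_bij_witness[where i = snd and j = "\<lambda>n. (0, n)",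
            THEN iffD1, OF _ _ _ _ _ refl zeta])
         (auto simp: f_def)
    with R have "(f z has_sum (2 * of_real s + R)) (- {(0, 0)})"
      unfolding split by (intro has_sum_Un_disjoint) auto
    then show ?thesis using f_sum[OF z] R_eq has_sum_unique by blast
  qed
  have transf: "G (- 1 / z) = z ^ 4 * G z" if z: "Im z > 0" for z
  proof -
    have "z \<noteq> 0" using z by auto
    have "of_int m * (- 1 / z) + of_int n = (of_int n * z + of_int (- m)) / z" for m n :: int
      using \<open>z \<noteq> 0\<close> by (simp add: field_simps)
    then have eq: "f (- 1 / z) (m, n) = z ^ 4 * f z (n, - m)" for m n
      unfolding f_def by (simp add: power_divide)
    define w where "w = - 1 / z"
    have "(f w has_sum (z ^ 4 * G z)) (- {(0, 0)})"
      by (rule has_sum_reindex_bij_witness[where i = "\<lambda>(m, n). (n, - m)" and j = "\<lambda>(n, m). (- m, n)",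
            THEN iffD1, OF _ _ _ _ _ refl has_sum_cmult_right[OF f_sum[OF z]]])
         (auto simp: eq[folded w_def])
    then show ?thesis
      unfolding w_def using f_sum[OF Im_minus_inverse_pos[OF z]] has_sum_unique by blast
  qed
  \<comment> \<open>Here \<open>s\<close> is zeta(4), and the series is normalised by its constant
    term 2 zeta(4).\<close>
  define \<kappa> where "\<kappa> = 8 * pi ^ 4 / (3 * s)"
  have L3: "Lipschitz_const 3 = of_real (8 * pi ^ 4 / 3)"
    by (simp add: Lipschitz_const_def eval_nat_numeral power_mult_distrib)
  have G': "G z = 2 * of_real s * (1 + of_real \<kappa> * eval_fps (sigma_fps 3) (nome z))" if "Im z > 0" for z
    unfolding G[OF that] L3 \<kappa>_def using \<open>s \<ge> 1\<close> by (simp add: field_simps)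
  show ?thesis
  proof (rule that)
    show "\<kappa> > 0" using \<open>s \<ge> 1\<close> by (simp add: \<kappa>_def)
    fix z assume z: "Im z > 0"
    have "2 * of_real s * (1 + of_real \<kappa> * eval_fps (sigma_fps 3) (nome (- 1 / z))) =
            2 * of_real s * (z ^ 4 * (1 + of_real \<kappa> * eval_fps (sigma_fps 3) (nome z)))"
      using transf[OF z] unfolding G'[OF z] G'[OF Im_minus_inverse_pos[OF z]] by (simp only: mult_ac)
    then show "1 + of_real \<kappa> * eval_fps (sigma_fps 3) (nome (- 1 / z)) =
               z ^ 4 * (1 + of_real \<kappa> * eval_fps (sigma_fps 3) (nome z))"
      by (rule mult_left_cancel[THEN iffD1, rotated]) (use \<open>s \<ge> 1\<close> in simp)
  qed
qed

section \<open>The discriminant\<close>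

lemma has_sum_int_symmetric_limit:
  fixes f :: "int \<Rightarrow> 'a :: {comm_monoid_add, topological_space}"
  assumes "(f has_sum s) UNIV"
  shows "(\<lambda>N. \<Sum>n\<in>{- int N<..int N}. f n) \<longlonglongrightarrow> s"
proof -
  have "filterlim (\<lambda>N. {- int N<..int N}) (finite_subsets_at_top UNIV) sequentially"
  proof (subst filterlim_finite_subsets_at_top, safe)
    fix X :: "int set" assume X: "finite X"
    define M where "M = Max (insert 0 (abs ` X))"
    have M: "\<bar>x\<bar> \<le> M" if "x \<in> X" for x
      unfolding M_def using X that by (intro Max_ge) auto
    have "X \<subseteq> {- int N<..int N}" if "N \<ge> nat M + 1" for N
    proof
      fix x assume "x \<in> X"
      from M[OF this] that show "x \<in> {- int N<..int N}" by auto
    qed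
    then show "\<forall>\<^sub>F N in sequentially. finite {- int N<..int N} \<and> X \<subseteq> {- int N<..int N} \<and> {- int N<..int N} \<subseteq> UNIV"
      unfolding eventually_sequentially by blast
  qed
  from filterlim_compose[OF assms[unfolded has_sum_def] this] show ?thesis .
qed

text \<open>The blocks are half-open so that the telescoped end points are exactly -N and N.\<close>

lemma sum_int_telescope:
  fixes g :: "int \<Rightarrow> 'a :: ab_group_add"
  shows "(\<Sum>n\<in>{- int N<..int N}. g (n - 1) - g n) = g (- int N) - g (int N)"
proof (induction N)
  case (Suc N)
  have "{- int (Suc N)<..int (Suc N)} = insert (- int N) (insert (int N + 1) {- int N<..int N})"
    by auto
  then show ?case using Suc by (simp add: algebra_simps minus_diff_commute)
qed auto

lemma tendsto_inverse_shifted_of_nat: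
  fixes c :: complex
  shows "(\<lambda>N. 1 / (c + of_nat N)) \<longlonglongrightarrow> 0"
  by (intro tendsto_divide_0[OF tendsto_const] tendsto_add_filterlim_at_infinity[OF tendsto_const] tendsto_of_nat)

lemma sums_Digamma_diff:
  fixes v w :: complex
  assumes "v \<noteq> 0" "w \<noteq> 0"
  shows "(\<lambda>k. 1 / (v + of_nat k) - 1 / (w + of_nat k)) sums (Digamma w - Digamma v)"
proof -
  have *: "(\<lambda>k. inverse (of_nat (Suc k)) - inverse (z + of_nat k)) sums (Digamma z + euler_mascheroni)"
    if "z \<noteq> 0" for z :: complex
    using summable_sums[OF summable_Digamma[OF that]] by (simp add: Digamma_def)
  show ?thesis
    using sums_diff[OF *[OF assms(2)] *[OF assms(1)]] by (simp add: inverse_eq_divide)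
qed

text \<open>The difference of the Digamma series at 1 + w and 1 - w; the recurrence from w to 1 + w
  contributes 1 / w, and the reflection formula the cotangent.\<close>

lemma cot_partial_fractions:
  fixes w :: complex
  assumes "w \<notin> \<int>"
  shows "(\<lambda>k. 1 / (of_nat (Suc k) - w) - 1 / (of_nat (Suc k) + w)) sums
           (1 / w - of_real pi * cot (of_real pi * w))"
proof -
  have nz: "1 - w \<noteq> 0" "w \<noteq> 0"
    using assms by auto
  have nz': "1 + w \<noteq> 0"
    using assms by (metis Ints_1 Ints_minus add_eq_0_iff)
  have "Digamma (1 + w) = Digamma w + 1 / w"
    using Digamma_plus1[OF nz(2)] by (simp add: add.commute)
  then have eq: "Digamma (1 + w) - Digamma (1 - w) = 1 / w - of_real pi * cot (of_real pi * w)"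
    using Digamma_reflection[OF assms] by (simp add: algebra_simps)
  then show ?thesis
    using sums_Digamma_diff[OF nz(1) nz'] unfolding eq by (simp add: algebra_simps)
qed

lemma has_sum_sum:
  fixes f :: "'a \<Rightarrow> 'b \<Rightarrow> 'c :: topological_comm_monoid_add"
  assumes "finite F" "\<And>n. n \<in> F \<Longrightarrow> (f n has_sum s n) A"
  shows "((\<lambda>m. \<Sum>n\<in>F. f n m) has_sum (\<Sum>n\<in>F. s n)) A"
  using assms by (induction F rule: finite_induct) (auto intro: has_sum_add)

lemma has_sum_diff:
  fixes f g :: "'a \<Rightarrow> 'b :: real_normed_vector"
  assumes "(f has_sum a) A" "(g has_sum b) A"
  shows "((\<lambda>x. f x - g x) has_sum (a - b)) A"
  using has_sum_add[OF assms(1), of "\<lambda>x. - g x" "- b"] assms(2) by (simp add: has_sum_uminus)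

text \<open>The limit of the Eisenstein-ordered sums of the telescoping correction terms; it is the
  source of the non-modular term of \<open>E2\<close>.\<close>
lemma correction_limit:
  assumes z: "Im z > 0"
    and T: "\<And>N. ((\<lambda>m. 1 / (of_int m * z - of_nat N) - 1 / (of_int m * z + of_nat N)) has_sum T N) (- {0 :: int})"
  shows "T \<longlonglongrightarrow> - 2 * of_real pi * \<i> / z"
proof -
  have z0: "z \<noteq> 0" using z by auto
  define q where "q = nome (- 1 / z)"
  have q: "norm q < 1" unfolding q_def by (intro norm_nome_less_1 Im_minus_inverse_pos z)
  have T_eq: "T N = 2 / z * (z * (1 / of_nat N) + of_real pi * \<i> - 2 * of_real pi * \<i> / (1 - q ^ N))"
    if N: "N \<ge> 1" for N
  proof -
    \<comment> \<open>Dividing by z turns the sum over m into the cotangent series at w. The point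
      -w, not w, lies in the upper half plane, so the nome expansion is applied at -w and oddness of
      the cotangent is used.\<close>
    define w where "w = of_nat N / z"
    have "- w = of_real (real N) * (- 1 / z)" by (simp add: w_def)
    then have "Im (- w) = real N * Im (- 1 / z)" by (simp only: times_complex.sel Re_complex_of_real Im_complex_of_real)
    then have Imw: "Im (- w) > 0"
      using Im_minus_inverse_pos[OF z] N by (simp only:) (intro mult_pos_pos, auto)
    then have "- w \<notin> \<int>" using not_Ints_Im_pos by blast
    then have w: "w \<notin> \<int>" using Ints_minus by blast
    have "((\<lambda>m::int. 1 / (of_int m * z - of_nat N) - 1 / (of_int m * z + of_nat N)) has_sum 2 * (T N / 2)) (- {0})"
      using T[of N] by simp
    then have "((\<lambda>k. 1 / (of_int (int (Suc k)) * z - of_nat N) - 1 / (of_int (int (Suc k)) * z + of_nat N)) has_sum T N / 2) UNIV"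
    proof (subst (asm) has_sum_even_int)
      fix n :: int
      have *: "1 / (- a - b) - 1 / (- a + b) = 1 / (a - b) - 1 / (a + b)" for a b :: complex
      proof -
        have "- a - b = - (a + b)" "- a + b = - (a - b)" by simp_all
        then show ?thesis by (simp only: divide_minus_right) simp
      qed
      show "1 / (of_int (- n) * z - of_nat N) - 1 / (of_int (- n) * z + of_nat N) =
            1 / (of_int n * z - of_nat N) - 1 / (of_int n * z + of_nat N)"
        using *[of "of_int n * z" "of_nat N"] by simp
    qed
    then have s1: "(\<lambda>k. 1 / (of_int (int (Suc k)) * z - of_nat N) - 1 / (of_int (int (Suc k)) * z + of_nat N)) sums (T N / 2)"
      by (rule has_sum_imp_sums)
    have e: "1 / (of_int (int (Suc k)) * z - of_nat N) - 1 / (of_int (int (Suc k)) * z + of_nat N)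
            = 1 / z * (1 / (of_nat (Suc k) - w) - 1 / (of_nat (Suc k) + w))" for k
    proof -
      have "of_int (int (Suc k)) * z - of_nat N = z * (of_nat (Suc k) - w)"
           "of_int (int (Suc k)) * z + of_nat N = z * (of_nat (Suc k) + w)"
        using z0 by (simp_all add: w_def field_simps)
      then show ?thesis by (simp add: right_diff_distrib)
    qed
    have "T N / 2 = 1 / z * (1 / w - of_real pi * cot (of_real pi * w))"
      using s1 sums_mult[OF cot_partial_fractions[OF w], of "1 / z"] unfolding e by (rule sums_unique2)
    moreover have "nome (- w) = q ^ N"
      using nome_of_nat_mult[of N "- 1 / z"] by (simp add: q_def w_def)
    then have "of_real pi * cot (of_real pi * (- w)) = of_real pi * \<i> - 2 * of_real pi * \<i> / (1 - q ^ N)"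
      using pi_cot_conv_nome[OF Imw] eval_power_fps_0[OF norm_nome_less_1[OF Imw]] by simp
    then have "of_real pi * cot (of_real pi * w) = - (of_real pi * \<i> - 2 * of_real pi * \<i> / (1 - q ^ N))"
      by (simp add: minus_equation_iff[of "of_real pi * cot _"])
    ultimately have "T N / 2 = 1 / z * (z * (1 / of_nat N) + of_real pi * \<i> - 2 * of_real pi * \<i> / (1 - q ^ N))"
      by (simp only: w_def) simp
    then show ?thesis by simp
  qed
  \<comment> \<open>Both 1 / N and q ^ N tend to 0, leaving 2 / z times pi i - 2 pi i.\<close>
  have "(\<lambda>N. 2 / z * (z * (1 / of_nat N) + of_real pi * \<i> - 2 * of_real pi * \<i> / (1 - q ^ N)))
          \<longlonglongrightarrow> 2 / z * (z * 0 + of_real pi * \<i> - 2 * of_real pi * \<i> / (1 - 0))"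
    using q tendsto_inverse_shifted_of_nat[of 0] by (intro tendsto_intros LIMSEQ_power_zero) auto
  then have "(\<lambda>N. 2 / z * (z * (1 / of_nat N) + of_real pi * \<i> - 2 * of_real pi * \<i> / (1 - q ^ N)))
          \<longlonglongrightarrow> - 2 * of_real pi * \<i> / z" by (simp add: algebra_simps)
  then show ?thesis
    by (rule Lim_transform_eventually)
       (use T_eq in \<open>auto simp: eventually_sequentially intro!: exI[of _ 1]\<close>)
qed

text \<open>The weight 2 lattice sum divided by 2 zeta(2) = pi^2 / 3; the coefficient is 2 (2 pi
  i)^2 / (pi^2 / 3) = -24.\<close>

definition E2 :: "complex \<Rightarrow> complex" where
  "E2 z = 1 - 24 * eval_fps (sigma_fps 1) (nome z)"

text \<open>Summing 1 / (m z + n)^2 by rows leads to \<open>E2\<close> at z, by columns to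
  \<open>E2\<close> at -1 / z. Subtracting the telescoping term \<open>b\<close> leaves a remainder
  \<open>d\<close> of cubic decay, for which the order is irrelevant. The rows of \<open>b\<close>
  sum to 0, but its columns do not cancel: their total is the anomaly.\<close>

theorem E2_transformation:
  assumes z: "Im z > 0"
  shows "E2 (- 1 / z) = z\<^sup>2 * E2 z + 6 * z / (of_real pi * \<i>)"
proof -
  have z0: "z \<noteq> 0" using z by auto
  have z': "Im (- 1 / z) > 0" using z by (rule Im_minus_inverse_pos)
  define a where "a = (\<lambda>m n. 1 / (of_int m * z + of_int n) ^ 2)"
  define g where "g = (\<lambda>m n. 1 / (of_int m * z + of_int n))"
  define b where "b = (\<lambda>m n. g m (n - 1) - g m n)"
  define d where "d = (\<lambda>m n. a m n - b m n)"
  define \<phi> where "\<phi> = (\<lambda>z m. Lipschitz_const 1 * eval_fps (power_fps 1) (nome z ^ nat \<bar>m\<bar>))"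
  define P where "P = (\<lambda>z. 2 * (Lipschitz_const 1 * eval_fps (sigma_fps 1) (nome z)))"
  have P: "(\<phi> z has_sum P z) (- {0})" if "Im z > 0" for z
    unfolding \<phi>_def P_def using that by (rule Lambert_int_has_sum) auto
  have d_sum: "(\<lambda>(m, n). d m n) summable_on (- {0}) \<times> UNIV"
  proof -
    obtain c where c: "c > 0" "\<And>x y. norm (of_real x * z + of_real y) \<ge> c * (\<bar>x\<bar> + \<bar>y\<bar>)"
      using lattice_lower_bound[OF z] by blast
    have "(\<lambda>x. norm (case x of (m, n) \<Rightarrow> d m n)) summable_on (- {0}) \<times> UNIV"
    proof (rule Infinite_Sum.abs_summable_on_comparison_test')
      show "(\<lambda>x. (2 / c ^ 3) * 8 * (case x of (m, n) \<Rightarrow> lattice_weight m * lattice_weight n)) summable_on (- {0}) \<times> UNIV"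
        by (intro summable_on_cmult_right summable_on_subset[OF lattice_weight_product_summable]) auto
    next
      fix x :: "int \<times> int" assume x: "x \<in> (- {0}) \<times> UNIV"
      obtain m n where mn: "x = (m, n)" by (cases x)
      have m: "\<bar>real_of_int m\<bar> \<ge> 1" using x mn by auto
      define s where "s = \<bar>real_of_int m\<bar> + \<bar>of_int n\<bar>"
      define w where "w = of_int m * z + of_int n"
      have s: "s \<ge> 1" using m by (simp add: s_def)
      have w1: "norm w \<ge> c * s"
        using c(2)[of "of_int m" "of_int n"] by (simp add: w_def s_def)
      \<comment> \<open>Here |m| >= 1 enters: moving n by 1 changes |m| + |n| by at most 1, so at
        least half of it survives and w - 1 has a lower bound of the same kind as w.\<close>
      have avg: "(u + v) / 2 \<le> u + v'" if "v \<le> v' + 1" "1 \<le> u" "0 \<le> v'" for u v v' :: real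
        using that by (simp add: field_simps)
      have "\<bar>real_of_int n\<bar> \<le> \<bar>real_of_int (n - 1)\<bar> + 1" by simp
      from avg[OF this m] have "s / 2 \<le> \<bar>real_of_int m\<bar> + \<bar>real_of_int (n - 1)\<bar>"
        unfolding s_def by (simp only: abs_ge_zero)
      then have "c * (s / 2) \<le> c * (\<bar>real_of_int m\<bar> + \<bar>real_of_int (n - 1)\<bar>)"
        using c by (intro mult_left_mono) auto
      also have "\<dots> \<le> norm (w - 1)"
        using c(2)[of "of_int m" "of_int (n - 1)"] by (simp add: w_def add_diff_eq)
      finally have w2: "norm (w - 1) \<ge> c * (s / 2)" .
      have cs: "c * s > 0" "c * (s / 2) > 0" using c s by auto
      have nz: "w \<noteq> 0" "w - 1 \<noteq> 0" using w1 w2 cs by auto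
      have "1 / w ^ 2 - (1 / (w - 1) - 1 / w) = - 1 / (w ^ 2 * (w - 1))"
        using nz by (simp add: divide_simps) (simp add: algebra_simps power2_eq_square)
      then have "d m n = - 1 / (w ^ 2 * (w - 1))"
        by (simp add: d_def a_def b_def g_def w_def algebra_simps)
      then have "norm (d m n) = 1 / (norm w ^ 2 * norm (w - 1))"
        by (simp add: norm_divide norm_mult norm_power)
      also have "\<dots> \<le> 1 / ((c * s) ^ 2 * (c * (s / 2)))"
        using c s cs w1 w2 by (intro frac_le mult_mono power_mono mult_pos_pos zero_less_power) auto
      also have "\<dots> = (2 / c ^ 3) * (1 / s ^ 3)"
        by (simp add: power2_eq_square power3_eq_cube)
      also have "\<dots> \<le> (2 / c ^ 3) * (8 * (lattice_weight m * lattice_weight n))"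
        unfolding s_def using c x mn by (intro mult_left_mono inverse_cube_le_lattice_weight) auto
      finally show "norm (case x of (m, n) \<Rightarrow> d m n) \<le>
          (2 / c ^ 3) * 8 * (case x of (m, n) \<Rightarrow> lattice_weight m * lattice_weight n)"
        by (simp add: mn)
    qed
    then show ?thesis by (rule abs_summable_summable)
  qed
  define D where "D = infsum (\<lambda>(m, n). d m n) ((- {0}) \<times> UNIV)"
  have D: "((\<lambda>(m, n). d m n) has_sum D) ((- {0}) \<times> UNIV)"
    unfolding D_def using d_sum by simp

  have a_row: "(a m has_sum \<phi> z m) UNIV" if "m \<noteq> 0" for m
    using lattice_row_sum[OF z _ that, of 1] unfolding a_def \<phi>_def by (simp add: numeral_2_eq_2)
  \<comment> \<open>Summability of a row of \<open>b\<close> is inherited from \<open>a\<close> and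
    \<open>d\<close>; its value may then be computed along half-open blocks, where it telescopes to
    0.\<close>
  have b_row: "(b m has_sum 0) UNIV" if m: "m \<noteq> 0" for m
  proof -
    have "d m summable_on UNIV"
      using summable_on_SigmaD1[OF d_sum, of m] m by simp
    then obtain t where "(d m has_sum t) UNIV" by (auto simp: summable_on_def)
    from has_sum_diff[OF a_row[OF m] this] have t: "(b m has_sum (\<phi> z m - t)) UNIV"
      by (simp add: d_def)
    have "(\<lambda>N. \<Sum>n\<in>{- int N<..int N}. b m n) \<longlonglongrightarrow> 0"
    proof -
      have "(\<lambda>N. - (1 / (- (of_int m * z) + of_nat N)) - 1 / (of_int m * z + of_nat N)) \<longlonglongrightarrow> - 0 - 0"
        by (intro tendsto_intros tendsto_inverse_shifted_of_nat)
      also have "(\<lambda>N. - (1 / (- (of_int m * z) + of_nat N)) - 1 / (of_int m * z + of_nat N)) =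
                 (\<lambda>N. g m (- int N) - g m (int N))"
        by (simp add: g_def fun_eq_iff minus_divide_right)
      finally show ?thesis unfolding b_def sum_int_telescope by simp
    qed
    with has_sum_int_symmetric_limit[OF t] have "\<phi> z m - t = 0" by (rule LIMSEQ_unique)
    with t show ?thesis by simp
  qed
  have d_row: "(d m has_sum \<phi> z m) UNIV" if "m \<noteq> 0" for m
    using has_sum_diff[OF a_row[OF that] b_row[OF that]] by (simp add: d_def)
  have "(\<phi> z has_sum D) (- {0})"
    by (rule has_sum_SigmaD[OF D]) (use d_row in auto)
  with P[OF z] have D_eq: "D = P z" by (metis has_sum_unique)

  \<comment> \<open>Column sums of \<open>a\<close> over nonzero m. For n = 0 this is 2 zeta(2) /
    z^2; for other n the full column is a lattice row for -1 / z, from which the term at m = 0 is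
    removed.\<close>
  define \<alpha> where "\<alpha> = (\<lambda>n. if n = 0 then of_real (pi\<^sup>2 / 3) / z\<^sup>2 else 1 / z\<^sup>2 * \<phi> (- 1 / z) n - 1 / of_int n ^ 2)"
  have zeta: "((\<lambda>n::int. 1 / of_int n ^ 2) has_sum (of_real (pi\<^sup>2 / 3) :: complex)) (- {0})"
  proof -
    have sq: "(\<lambda>k. 1 / (real k + 1)\<^sup>2) sums (pi\<^sup>2 / 6)"
      using inverse_squares_sums by (simp add: add.commute)
    then have "((\<lambda>k. 1 / (real k + 1)\<^sup>2) has_sum (pi\<^sup>2 / 6)) UNIV"
      using sums_summable[OF sq] by (intro norm_summable_imp_has_sum) simp_all
    then have "((\<lambda>k. of_real (1 / (real k + 1)\<^sup>2) :: complex) has_sum of_real (pi\<^sup>2 / 6)) UNIV"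
      by (rule has_sum_of_real)
    then have "((\<lambda>n::int. 1 / of_int n ^ 2) has_sum (2 * of_real (pi\<^sup>2 / 6) :: complex)) (- {0})"
      by (subst has_sum_even_int) (simp_all add: add.commute)
    then show ?thesis by simp
  qed
  have a_col: "((\<lambda>m. a m n) has_sum \<alpha> n) (- {0})" for n
  proof (cases "n = 0")
    case True
    have "a m 0 = 1 / z\<^sup>2 * (1 / of_int m ^ 2)" for m
      by (simp add: a_def power_mult_distrib)
    then show ?thesis
      using has_sum_cmult_right[OF zeta, of "1 / z\<^sup>2"] True by (simp add: \<alpha>_def mult.commute)
  next
    case False
    have eq: "a m n = 1 / z\<^sup>2 * (1 / (of_int n * (- 1 / z) + of_int (- m)) ^ Suc 1)" for m
    proof -
      have "of_int m * z + of_int n = - z * (of_int n * (- 1 / z) + of_int (- m))"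
        using z0 by (simp add: field_simps)
      then show ?thesis unfolding a_def by (simp only: power_mult_distrib) (simp add: numeral_2_eq_2)
    qed
    have "((\<lambda>m. a m n) has_sum (1 / z\<^sup>2 * \<phi> (- 1 / z) n)) UNIV"
      unfolding \<phi>_def
      by (rule has_sum_reindex_bij_witness[where i = uminus and j = uminus, THEN iffD1, OF _ _ _ _ _ refl
                 has_sum_cmult_right[OF lattice_row_sum[OF z' _ False]]])
         (simp_all only: eq minus_minus UNIV_I odd_one not_False_eq_True)
    moreover have "((\<lambda>m. a m n) has_sum a 0 n) {0}" by (rule has_sum_finiteI) auto
    ultimately have "((\<lambda>m. a m n) has_sum (1 / z\<^sup>2 * \<phi> (- 1 / z) n - a 0 n)) (UNIV - {0})"
      by (rule has_sum_Diff) auto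
    then show ?thesis using False by (simp add: \<alpha>_def a_def Compl_eq_Diff_UNIV)
  qed
  have "((\<lambda>(n, m). d m n) has_sum D) (UNIV \<times> (- {0}))"
    using D by (subst has_sum_swap) simp
  note D' = this
  have "\<exists>t. ((\<lambda>m. b m n) has_sum t) (- {0})" for n
  proof -
    have "(\<lambda>m. d m n) summable_on (- {0})"
      using summable_on_SigmaD1[OF has_sum_imp_summable[OF D'], of n] by simp
    then obtain t where "((\<lambda>m. d m n) has_sum t) (- {0})" by (auto simp: summable_on_def)
    from has_sum_diff[OF a_col[of n] this] show ?thesis unfolding d_def by auto
  qed
  then obtain \<beta> where \<beta>: "\<And>n. ((\<lambda>m. b m n) has_sum \<beta> n) (- {0})" by metis
  have "((\<lambda>n. \<alpha> n - \<beta> n) has_sum D) UNIV"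
    by (rule has_sum_SigmaD[OF D']) (use has_sum_diff[OF a_col \<beta>] in \<open>simp add: d_def\<close>)
  note \<alpha>\<beta> = this
  define A where "A = of_real (pi\<^sup>2 / 3) / z\<^sup>2 + (1 / z\<^sup>2 * P (- 1 / z) - of_real (pi\<^sup>2 / 3))"
  have "((\<lambda>n. 1 / z\<^sup>2 * \<phi> (- 1 / z) n - 1 / of_int n ^ 2) has_sum
           (1 / z\<^sup>2 * P (- 1 / z) - of_real (pi\<^sup>2 / 3))) (- {0})"
    by (intro has_sum_diff has_sum_cmult_right zeta P z')
  then have "(\<alpha> has_sum (1 / z\<^sup>2 * P (- 1 / z) - of_real (pi\<^sup>2 / 3))) (- {0})"
    by (rule has_sum_cong[THEN iffD1, rotated]) (simp add: \<alpha>_def)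
  then have "(\<alpha> has_sum (\<alpha> 0 + (1 / z\<^sup>2 * P (- 1 / z) - of_real (pi\<^sup>2 / 3)))) (insert 0 (- {0}))"
    by (intro has_sum_insert) auto
  moreover have "insert 0 (- {0 :: int}) = UNIV" by auto
  ultimately have "(\<alpha> has_sum A) UNIV" by (simp add: A_def \<alpha>_def)
  from has_sum_diff[OF this \<alpha>\<beta>] have "(\<beta> has_sum (A - D)) UNIV" by simp
  then have lim: "(\<lambda>N. \<Sum>n\<in>{- int N<..int N}. \<beta> n) \<longlonglongrightarrow> A - D"
    by (rule has_sum_int_symmetric_limit)
  \<comment> \<open>Finitely many columns may be added under the sum over m; there \<open>b\<close>
    telescopes in n to the expression of \<open>correction_limit\<close>.\<close>
  have "(\<lambda>N. \<Sum>n\<in>{- int N<..int N}. \<beta> n) \<longlonglongrightarrow> - 2 * of_real pi * \<i> / z"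
  proof (rule correction_limit[OF z])
    fix N
    have "((\<lambda>m. \<Sum>n\<in>{- int N<..int N}. b m n) has_sum (\<Sum>n\<in>{- int N<..int N}. \<beta> n)) (- {0})"
      by (rule has_sum_sum) (use \<beta> in auto)
    then show "((\<lambda>m. 1 / (of_int m * z - of_nat N) - 1 / (of_int m * z + of_nat N)) has_sum
            (\<Sum>n\<in>{- int N<..int N}. \<beta> n)) (- {0})"
      unfolding b_def sum_int_telescope by (simp add: g_def)
  qed
  with lim have "A - D = - 2 * of_real pi * \<i> / z" by (rule LIMSEQ_unique)
  then have "P z = A + 2 * of_real pi * \<i> / z" by (simp add: D_eq algebra_simps)
  moreover have "P z = - 8 * of_real pi ^ 2 * eval_fps (sigma_fps 1) (nome z)" for z
    by (simp add: P_def Lipschitz_const_def power2_eq_square algebra_simps)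
  then have "P z = of_real pi ^ 2 / 3 * (E2 z - 1)" for z
    by (simp add: E2_def)
  ultimately have "of_real pi ^ 2 / 3 * (E2 z - 1) =
      of_real pi ^ 2 / 3 / z\<^sup>2 + (1 / z\<^sup>2 * (of_real pi ^ 2 / 3 * (E2 (- 1 / z) - 1)) - of_real pi ^ 2 / 3) +
        2 * of_real pi * \<i> / z"
    by (simp add: A_def)
  then have "3 * z\<^sup>2 * (of_real pi ^ 2 / 3 * (E2 z - 1)) = 3 * z\<^sup>2 *
     (of_real pi ^ 2 / 3 / z\<^sup>2 + (1 / z\<^sup>2 * (of_real pi ^ 2 / 3 * (E2 (- 1 / z) - 1)) - of_real pi ^ 2 / 3) +
        2 * of_real pi * \<i> / z)" (is "_ = ?R")
    by (simp only:)
  also have "?R = of_real pi ^ 2 + of_real pi ^ 2 * (E2 (- 1 / z) - 1) - of_real pi ^ 2 * z\<^sup>2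
                    + 6 * of_real pi * \<i> * z"
    using z0 by (simp add: field_simps power2_eq_square)
  finally have "z\<^sup>2 * (of_real pi ^ 2 * (E2 z - 1)) = of_real pi ^ 2 + of_real pi ^ 2 * (E2 (- 1 / z) - 1)
      - of_real pi ^ 2 * z\<^sup>2 + 6 * of_real pi * \<i> * z"
    by simp
  then have "of_real pi ^ 2 * (z\<^sup>2 * E2 z) = of_real pi ^ 2 * E2 (- 1 / z) + 6 * of_real pi * \<i> * z"
    by (simp add: algebra_simps)
  then have "z\<^sup>2 * E2 z = (of_real pi ^ 2 * E2 (- 1 / z) + 6 * of_real pi * \<i> * z) / of_real pi ^ 2"
    by (simp add: field_simps)
  also have "\<dots> = E2 (- 1 / z) - 6 * z / (of_real pi * \<i>)"
  proof -
    have "6 * p * \<i> * z / p ^ 2 = - (6 * z / (p * \<i>))" if "p \<noteq> 0" for p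
    proof -
      have "6 * z / (p * \<i>) = - (6 * \<i> * z) / p"
        using that by (subst frac_eq_eq) (simp_all add: algebra_simps)
      then show ?thesis using that by (simp add: power2_eq_square)
    qed
    from this[of "of_real pi"] show ?thesis by (simp add: add_divide_distrib)
  qed
  finally show ?thesis by (simp add: algebra_simps)
qed

text \<open>Minus the logarithm of the Euler product of all 1 - q^n, because sigma(n) / n is the sum
  of 1 / d over d dividing n. At n = 0 the coefficient is 0 / 0 = 0.\<close>

definition log_Delta_fps :: "complex fps" where
  "log_Delta_fps = Abs_fps (\<lambda>n. of_nat (divisor_sum 1 n) / of_nat n)"

lemma log_Delta_fps_deriv: "fps_X * fps_deriv log_Delta_fps = sigma_fps 1"
proof (rule fps_ext)
  fix n show "fps_nth (fps_X * fps_deriv log_Delta_fps) n = fps_nth (sigma_fps 1) n"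
    by (cases n) (simp_all add: log_Delta_fps_def del: of_nat_Suc)
qed

lemma fps_conv_radius_log_Delta: "fps_conv_radius log_Delta_fps \<ge> 1"
  unfolding fps_conv_radius_def
proof (rule conv_radius_geI_ex')
  fix r :: real assume r: "r > 0" "ereal r < 1"
  have "ereal (norm (of_real r :: complex)) < conv_radius (fps_nth (sigma_fps 1))"
    using less_fps_conv_radius[OF fps_conv_radius_sigma_fps[of 1], of "complex_of_real r"] r
    unfolding fps_conv_radius_def by (simp add: one_ereal_def)
  then have "summable (\<lambda>n. norm (fps_nth (sigma_fps 1) n * complex_of_real r ^ n))"
    by (rule abs_summable_in_conv_radius)
  then show "summable (\<lambda>n. fps_nth log_Delta_fps n * complex_of_real r ^ n)"
  proof (rule summable_comparison_test'[where N = 1])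
    fix n :: nat assume n: "n \<ge> 1"
    have "real (divisor_sum 1 n) / real n \<le> real (divisor_sum 1 n) / 1"
      using n by (intro divide_left_mono) auto
    from mult_right_mono[OF this, of "r ^ n"] r
    show "norm (fps_nth log_Delta_fps n * complex_of_real r ^ n) \<le>
        norm (fps_nth (sigma_fps 1) n * complex_of_real r ^ n)"
      by (simp add: log_Delta_fps_def norm_mult norm_divide norm_power)
  qed
qed

text \<open>\<open>\<Delta>\<close> as a function of the nome \<open>q\<close>; by construction it has a simple zero at \<open>0\<close>, no other
  zero in the unit disc, and logarithmic derivative \<open>E2\<close>.\<close>
definition Delta :: "complex \<Rightarrow> complex" where
  "Delta q = q * exp (- 24 * eval_fps log_Delta_fps q)"

text \<open>\<open>W\<close> is a logarithm of \<Delta> on the upper half plane. The anomaly of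
  \<open>E2\<close> cancels exactly the derivative of 12 Ln z, so the two sides have logarithms
  differing by a constant.\<close>

theorem Delta_transformation:
  assumes "Im z > 0"
  shows "Delta (nome (- 1 / z)) = z ^ 12 * Delta (nome z)"
proof -
  define H where "H = {z. Im z > 0}"
  define W where "W = (\<lambda>z. 2 * of_real pi * \<i> * z - 24 * eval_fps log_Delta_fps (nome z))"
  have W_exp: "Delta (nome z) = exp (W z)" for z
    by (simp add: Delta_def W_def exp_diff exp_minus nome_def field_simps)
  have W: "(W has_field_derivative 2 * of_real pi * \<i> * E2 z) (at z)" if "Im z > 0" for z
  proof -
    have "(W has_field_derivative 2 * of_real pi * \<i> * 1 -
            24 * (2 * of_real pi * \<i> * eval_fps (sigma_fps 1) (nome z))) (at z)"
      unfolding W_def using has_field_derivative_eval_fps_nome[OF fps_conv_radius_log_Delta that]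
      by (intro DERIV_diff DERIV_cmult DERIV_ident) (simp add: log_Delta_fps_deriv)
    then show ?thesis by (simp add: E2_def algebra_simps)
  qed
  have "\<exists>c. \<forall>z\<in>H. W (- 1 / z) - W z - 12 * Ln z = c"
  proof (rule has_field_derivative_zero_constant)
    show "convex H" unfolding H_def by (rule convex_halfspace_Im_gt)
    fix z assume "z \<in> H"
    then have z: "Im z > 0" by (simp add: H_def)
    then have z0: "z \<noteq> 0" "z \<notin> \<real>\<^sub>\<le>\<^sub>0" by (auto simp: complex_nonpos_Reals_iff)
    have inv: "((\<lambda>z. - 1 / z) has_field_derivative 1 / z ^ 2) (at z)"
      using z0 by (auto intro!: derivative_eq_intros simp: power2_eq_square)
    have "((\<lambda>z. W (- 1 / z) - W z - 12 * Ln z) has_field_derivative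
            2 * of_real pi * \<i> * E2 (- 1 / z) * (1 / z ^ 2) - 2 * of_real pi * \<i> * E2 z - 12 * (1 / z)) (at z)"
      by (intro DERIV_diff DERIV_cmult DERIV_chain2[OF W inv] W z Im_minus_inverse_pos)
         (use has_field_derivative_Ln[OF z0(2)] in \<open>simp add: inverse_eq_divide\<close>)
    also have "2 * of_real pi * \<i> * E2 (- 1 / z) * (1 / z ^ 2) - 2 * of_real pi * \<i> * E2 z - 12 * (1 / z) = 0"
      unfolding E2_transformation[OF z] using z0
      by (simp add: field_simps power2_eq_square)
    finally show "((\<lambda>z. W (- 1 / z) - W z - 12 * Ln z) has_field_derivative 0) (at z within H)"
      by (rule has_field_derivative_at_within)
  qed
  then obtain c where c: "\<And>z. Im z > 0 \<Longrightarrow> W (- 1 / z) - W z - 12 * Ln z = c"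
    by (auto simp: H_def)
  \<comment> \<open>The fixed point i of the inversion determines the constant as -12 Ln i, a
    multiple of 2 pi i, so no multiplier remains.\<close>
  have "c = - 6 * of_real pi * \<i>"
    using c[of \<i>] by (auto simp: minus_divide_left [symmetric])
  then have "exp c = exp (of_int (- 3) * (2 * of_real pi * \<i>))"
    by (simp add: algebra_simps)
  then have exp_c: "exp c = 1" by (auto simp: exp_eq_1 intro!: exI[of _ "- 3"])
  have z0: "z \<noteq> 0" using assms by auto
  have "W (- 1 / z) = c + W z + 12 * Ln z" using c[OF assms] by (simp add: algebra_simps)
  then have "exp (W (- 1 / z)) = exp c * exp (W z) * exp (of_nat 12 * Ln z)"
    by (simp add: exp_add)
  also have "exp (of_nat 12 * Ln z) = z ^ 12"
    unfolding exp_of_nat_mult using z0 by simp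
  finally show ?thesis by (simp add: W_exp exp_c)
qed

section \<open>Modular forms as power series in the nome\<close>

text \<open>Only inversion is demanded, since the nome already has period 1. Products of forms
  become products of formal power series.\<close>

definition modular_fps :: "nat \<Rightarrow> complex fps \<Rightarrow> bool" where
  "modular_fps k F \<longleftrightarrow> fps_conv_radius F \<ge> 1 \<and>
     (\<forall>z. Im z > 0 \<longrightarrow> eval_fps F (nome (- 1 / z)) = z ^ k * eval_fps F (nome z))"

lemma modular_fpsD:
  assumes "modular_fps k F"
  shows "fps_conv_radius F \<ge> 1"
    and "Im z > 0 \<Longrightarrow> eval_fps F (nome (- 1 / z)) = z ^ k * eval_fps F (nome z)"
    and "norm q < 1 \<Longrightarrow> ereal (norm q) < fps_conv_radius F"
  using assms less_fps_conv_radius by (auto simp: modular_fps_def)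

text \<open>Convergence on the whole upper half plane amounts to radius at least 1 because every
  nonzero q in the unit disc is a nome.\<close>

lemma modform_iff_modular_fps: "c \<in> modform k \<longleftrightarrow> modular_fps k (Abs_fps c)"
proof -
  have e: "exp (2 * of_real pi * \<i> * of_nat n * z) = nome z ^ n" for n z
    unfolding nome_of_nat_mult [symmetric] by (simp add: nome_def mult_ac)
  have qexp: "qexp c z = eval_fps (Abs_fps c) (nome z)" for z
    by (simp add: qexp_def eval_fps_def e)
  have "(\<forall>z. Im z > 0 \<longrightarrow> summable (\<lambda>n. c n * nome z ^ n)) \<longleftrightarrow> conv_radius c \<ge> 1"
  proof (intro iffI allI impI)
    assume *: "\<forall>z. Im z > 0 \<longrightarrow> summable (\<lambda>n. c n * nome z ^ n)"
    show "conv_radius c \<ge> 1"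
    proof (rule conv_radius_geI_ex')
      fix r :: real assume r: "r > 0" "ereal r < 1"
      then obtain z where "Im z > 0" "nome z = of_real r"
        using nome_eqE[of "of_real r"] by (auto simp: one_ereal_def)
      with * show "summable (\<lambda>n. c n * of_real r ^ n)" by metis
    qed
  next
    fix z assume "conv_radius c \<ge> 1" "Im z > 0"
    then show "summable (\<lambda>n. c n * nome z ^ n)"
      using less_fps_conv_radius[of "Abs_fps c" "nome z"] norm_nome_less_1[of z]
      by (intro summable_in_conv_radius) (simp add: fps_conv_radius_def)
  qed
  then show ?thesis
    by (simp add: modform_def modular_fps_def e qexp fps_conv_radius_def)
qed

lemma modular_fps_add:
  assumes "modular_fps k F" "modular_fps k G"
  shows "modular_fps k (F + G)"
  unfolding modular_fps_def
proof (intro conjI allI impI)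
  show "fps_conv_radius (F + G) \<ge> 1"
    by (rule order_trans[OF _ fps_conv_radius_add]) (simp add: modular_fpsD(1)[OF assms(1)] modular_fpsD(1)[OF assms(2)])
  have e: "eval_fps (F + G) (nome z) = eval_fps F (nome z) + eval_fps G (nome z)" if "Im z > 0" for z
    using assms norm_nome_less_1[OF that] by (intro eval_fps_add modular_fpsD(3))
  fix z assume z: "Im z > 0"
  show "eval_fps (F + G) (nome (- 1 / z)) = z ^ k * eval_fps (F + G) (nome z)"
    unfolding e[OF z] e[OF Im_minus_inverse_pos[OF z]]
      modular_fpsD(2)[OF assms(1) z] modular_fpsD(2)[OF assms(2) z] by (simp add: distrib_left)
qed

lemma modular_fps_mult:
  assumes "modular_fps k F" "modular_fps l G"
  shows "modular_fps (k + l) (F * G)"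
  unfolding modular_fps_def
proof (intro conjI allI impI)
  show "fps_conv_radius (F * G) \<ge> 1"
    by (rule order_trans[OF _ fps_conv_radius_mult]) (simp add: modular_fpsD(1)[OF assms(1)] modular_fpsD(1)[OF assms(2)])
  have e: "eval_fps (F * G) (nome z) = eval_fps F (nome z) * eval_fps G (nome z)" if "Im z > 0" for z
    using assms norm_nome_less_1[OF that] by (intro eval_fps_mult modular_fpsD(3))
  fix z assume z: "Im z > 0"
  show "eval_fps (F * G) (nome (- 1 / z)) = z ^ (k + l) * eval_fps (F * G) (nome z)"
    unfolding e[OF z] e[OF Im_minus_inverse_pos[OF z]]
      modular_fpsD(2)[OF assms(1) z] modular_fpsD(2)[OF assms(2) z] by (simp add: power_add)
qed

lemma modular_fps_const: "modular_fps 0 (fps_const c)"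
  by (simp add: modular_fps_def)

lemma modular_fps_power: "modular_fps k F \<Longrightarrow> modular_fps (k * n) (F ^ n)"
proof (induction n)
  case 0
  show ?case using modular_fps_const[of 1] by simp
next
  case (Suc n)
  then show ?case using modular_fps_mult[of k F "k * n" "F ^ n"] by simp
qed

lemma modular_fps_E4:
  obtains \<kappa> :: real where "\<kappa> > 0" "modular_fps 4 (1 + fps_const (of_real \<kappa>) * sigma_fps 3)"
proof -
  obtain \<kappa> :: real where \<kappa>: "\<kappa> > 0"
    "\<And>z. Im z > 0 \<Longrightarrow> 1 + of_real \<kappa> * eval_fps (sigma_fps 3) (nome (- 1 / z)) =
               z ^ 4 * (1 + of_real \<kappa> * eval_fps (sigma_fps 3) (nome z))"
    using weight_four_Eisenstein by blast
  let ?G = "fps_const (of_real \<kappa>) * sigma_fps 3"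
  have G: "fps_conv_radius ?G \<ge> 1"
    by (rule order_trans[OF _ fps_conv_radius_mult]) (simp add: fps_conv_radius_sigma_fps)
  have rad: "fps_conv_radius (1 + ?G) \<ge> 1"
    by (rule order_trans[OF _ fps_conv_radius_add]) (simp add: G)
  have "eval_fps (1 + ?G) (nome z) = 1 + of_real \<kappa> * eval_fps (sigma_fps 3) (nome z)" if "Im z > 0" for z
    using less_fps_conv_radius[OF G norm_nome_less_1[OF that]]
      less_fps_conv_radius[OF fps_conv_radius_sigma_fps[of 3] norm_nome_less_1[OF that]]
    by (simp add: eval_fps_add eval_fps_mult)
  then have "modular_fps 4 (1 + ?G)"
    using rad \<kappa>(2) Im_minus_inverse_pos by (simp add: modular_fps_def)
  with \<kappa>(1) show ?thesis using that by blast
qed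

text \<open>\<open>U\<close> is the Taylor series of the zero-free factor \<Delta> / q. Splitting
  off \<open>fps_X\<close> makes the vanishing order and leading coefficient of powers of \<Delta>
  visible.\<close>

lemma modular_fps_Delta:
  obtains U where "fps_nth U 0 = 1" "modular_fps 12 (fps_X * U)"
proof -
  define u where "u = (\<lambda>q. exp (- 24 * eval_fps log_Delta_fps q))"
  define U where "U = fps_expansion u 0"
  have u: "u holomorphic_on eball 0 1"
    unfolding u_def one_ereal_def eball_ereal
    by (intro holomorphic_intros) (auto intro!: less_fps_conv_radius fps_conv_radius_log_Delta)
  have U: "fps_conv_radius U \<ge> 1" unfolding U_def by (rule conv_radius_fps_expansion[OF u])
  have eval_U: "eval_fps U q = u q" if "norm q < 1" for q
    unfolding U_def using eval_fps_expansion'[OF u, of q] that by (simp add: one_ereal_def)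
  have rad: "fps_conv_radius (fps_X * U) \<ge> 1"
    by (rule order_trans[OF _ fps_conv_radius_mult]) (simp add: U)
  have "eval_fps (fps_X * U) (nome z) = Delta (nome z)" if "Im z > 0" for z
    using less_fps_conv_radius[OF U norm_nome_less_1[OF that]] eval_U[OF norm_nome_less_1[OF that]]
    by (simp add: eval_fps_mult Delta_def u_def)
  then have "modular_fps 12 (fps_X * U)"
    using rad Delta_transformation Im_minus_inverse_pos by (simp add: modular_fps_def)
  moreover have "fps_nth U 0 = 1"
    using eval_U[of 0] by (simp add: eval_fps_at_0 u_def log_Delta_fps_def)
  ultimately show ?thesis using that by blast
qed

section \<open>Reduction in the upper half plane and vanishing of forms\<close>

text \<open>If the imaginary part is below 1/2, translating into the strip and inverting at least
  doubles it.\<close>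
lemma upper_half_plane_induct [consumes 1, case_names high translate invert]:
  assumes "Im z > 0"
    and high: "\<And>z. Im z \<ge> 1 / 2 \<Longrightarrow> P z"
    and translate: "\<And>z. Im z > 0 \<Longrightarrow> P (z + 1) \<longleftrightarrow> P z"
    and invert: "\<And>z. Im z > 0 \<Longrightarrow> P (- 1 / z) \<Longrightarrow> P z"
  shows "P z"
proof -
  have trans: "P (z + of_int m) \<longleftrightarrow> P z" if "Im z > 0" for z m
  proof (induction m rule: int_induct[where k = 0])
    case (step1 i)
    then show ?case using translate[of "z + of_int i"] that by (simp add: add_ac)
  next
    case (step2 i)
    then show ?case using translate[of "z + of_int (i - 1)"] that by (simp add: algebra_simps)
  qed auto
  have *: "P z" if "Im z > 0" "Im z * 2 ^ n \<ge> 1 / 2" for n z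
    using that
  proof (induction n arbitrary: z)
    case 0
    then show ?case using high by simp
  next
    case (Suc n)
    show ?case
    proof (cases "Im z \<ge> 1 / 2")
      case True
      then show ?thesis by (rule high)
    next
      case False
      \<comment> \<open>Translation by the nearest integer gives |Re w| <= 1/2; with Im w < 1/2 this
        yields |w|^2 <= 1/2, and inversion divides the imaginary part by |w|^2.\<close>
      define w where "w = z + of_int (- round (Re z))"
      have Im_w: "Im w = Im z" by (simp add: w_def)
      have "\<bar>Re w\<bar> \<le> 1 / 2"
        using of_int_round_abs_le[of "Re z"] by (simp add: w_def abs_minus_commute)
      then have "(Re w)\<^sup>2 \<le> (1 / 2)\<^sup>2" by (metis abs_ge_zero power2_abs power_mono)
      moreover have "(Im w)\<^sup>2 \<le> (1 / 2)\<^sup>2"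
        using False Suc.prems unfolding Im_w by (intro power_mono) auto
      ultimately have "(norm w)\<^sup>2 \<le> 1 / 2"
        unfolding cmod_power2 by (simp add: power2_eq_square)
      moreover have "(norm w)\<^sup>2 > 0" using Suc.prems Im_w by auto
      ultimately have "Im w / (norm w)\<^sup>2 \<ge> Im w / (1 / 2)"
        using Suc.prems Im_w by (intro divide_left_mono) auto
      then have "Im (- 1 / w) \<ge> 2 * Im z" unfolding Im_minus_inverse by (simp add: Im_w)
      then have "Im (- 1 / w) * 2 ^ n \<ge> 2 * Im z * 2 ^ n" by (rule mult_right_mono) auto
      with Suc.prems have "Im (- 1 / w) * 2 ^ n \<ge> 1 / 2" by (simp add: mult_ac)
      then have "P (- 1 / w)"
        using Suc.prems by (intro Suc.IH Im_minus_inverse_pos) (simp add: Im_w)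
      from invert[OF _ this] have "P w" using Suc.prems Im_w by simp
      then show ?thesis unfolding w_def using trans Suc.prems by blast
    qed
  qed
  obtain n where "(1 / 2) / Im z < 2 ^ n" using real_arch_pow[of 2] by auto
  with assms(1) show ?thesis by (intro *[of z n]) (auto simp: field_simps)
qed

text \<open>The threshold 1/2 of the reduction becomes a compact disc inside the unit disc, on which
  continuous functions of q are bounded.\<close>

lemma norm_nome_le: "Im z \<ge> 1 / 2 \<Longrightarrow> norm (nome z) \<le> exp (- pi)"
  by (simp add: norm_nome)

lemma cball_exp_minus_pi_subset: "cball 0 (exp (- pi)) \<subseteq> ball (0 :: complex) 1"
proof
  fix q :: complex assume "q \<in> cball 0 (exp (- pi))"
  then have "norm q \<le> exp (- pi)" by simp
  also have "\<dots> < 1" by simp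
  finally show "q \<in> ball 0 1" by simp
qed

lemma norm_attains_max:
  fixes f :: "complex \<Rightarrow> complex"
  assumes "continuous_on (cball 0 r) f" "r \<ge> 0"
  obtains q0 where "norm q0 \<le> r" "\<And>q. norm q \<le> r \<Longrightarrow> norm (f q) \<le> norm (f q0)"
proof -
  have "\<exists>x\<in>cball 0 r. \<forall>y\<in>cball 0 r. norm (f y) \<le> norm (f x)"
    by (rule continuous_attains_sup) (use assms in \<open>auto intro: continuous_on_norm\<close>)
  then show ?thesis using that by (metis mem_cball_0)
qed

lemma fps_conv_radius_pos: "fps_conv_radius F \<ge> 1 \<Longrightarrow> fps_conv_radius F > 0"
  by (rule less_le_trans[of _ 1]) (simp_all add: one_ereal_def)

lemma fps_eq_X_power_times_shift:
  assumes "\<And>n. n < l \<Longrightarrow> fps_nth F n = 0"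
  shows "F = fps_X ^ l * fps_shift l F"
  by (rule fps_ext) (use assms in \<open>auto simp: fps_X_power_mult_nth\<close>)

lemma eval_fps_shift_zero:
  fixes F :: "complex fps"
  assumes "\<And>n. n < l \<Longrightarrow> fps_nth F n = 0" "fps_conv_radius F \<ge> 1" "norm q < 1"
  shows "eval_fps F q = q ^ l * eval_fps (fps_shift l F) q"
proof -
  have "eval_fps F q = eval_fps (fps_X ^ l * fps_shift l F) q"
    using fps_eq_X_power_times_shift[OF assms(1)] by simp
  also have "\<dots> = q ^ l * eval_fps (fps_shift l F) q"
    using less_fps_conv_radius[OF assms(2,3)] by (subst eval_fps_mult) auto
  finally show ?thesis .
qed

lemma eval_fps_holomorphic_unit_ball:
  "fps_conv_radius F \<ge> 1 \<Longrightarrow> eval_fps F holomorphic_on ball 0 1"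
  by (intro holomorphic_on_eval_fps) (auto intro!: less_fps_conv_radius)

text \<open>The function \<open>F\<^sup>3 / \<Delta>\<^sup>m\<close> has weight 0, is holomorphic in the unit disc because \<open>\<Delta>\<close> has no
  zeros there, and vanishes at the cusp; the maximum principle shows that it is 0.\<close>
theorem modular_fps_eq_0:
  assumes F: "modular_fps (4 * m) F" and zero: "\<And>n. n \<le> m div 3 \<Longrightarrow> fps_nth F n = 0"
  shows "F = 0"
proof -
  \<comment> \<open>The cube of F vanishes to order at least 3 l and the m-th power of \<Delta> to
    order exactly m; e > 0 is the excess.\<close>
  define l where "l = Suc (m div 3)"
  define e where "e = 3 * l - m"
  have e: "e > 0" "e + m = 3 * l" by (auto simp: e_def l_def)
  define F1 where "F1 = fps_shift l F"
  note rad = modular_fpsD(1)[OF F]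
  have F1: "eval_fps F q = q ^ l * eval_fps F1 q" if "norm q < 1" for q
    unfolding F1_def using zero rad that by (intro eval_fps_shift_zero) (auto simp: l_def)
  \<comment> \<open>The quotient written without division: the exponential inverts the zero-free
    factor of the m-th power of \<Delta>.\<close>
  define G where "G = (\<lambda>q. q ^ e * eval_fps F1 q ^ 3 * exp (of_nat m * (24 * eval_fps log_Delta_fps q)))"
  have G_holo: "G holomorphic_on ball 0 1"
    unfolding G_def
    by (intro holomorphic_intros eval_fps_holomorphic_unit_ball)
       (use rad in \<open>auto intro!: less_fps_conv_radius fps_conv_radius_log_Delta simp: F1_def\<close>)
  have G_Delta: "G q * Delta q ^ m = eval_fps F q ^ 3" if "norm q < 1" for q
  proof -
    have "exp (of_nat m * (24 * eval_fps log_Delta_fps q)) * exp (- 24 * eval_fps log_Delta_fps q) ^ m = 1"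
      by (simp add: exp_of_nat_mult [symmetric] exp_add [symmetric])
    then have "G q * Delta q ^ m = q ^ (e + m) * eval_fps F1 q ^ 3"
      by (simp add: G_def Delta_def power_mult_distrib power_add mult_ac)
    also have "\<dots> = eval_fps F q ^ 3"
      using that by (simp add: F1 power_mult_distrib e(2) power_mult [symmetric] mult_ac)
    finally show ?thesis .
  qed
  have G_inv: "G (nome (- 1 / z)) = G (nome z)" if z: "Im z > 0" for z
  proof -
    have nz: "Delta (nome (- 1 / z)) ^ m \<noteq> 0" by (simp add: Delta_def)
    have "G (nome (- 1 / z)) * Delta (nome (- 1 / z)) ^ m = (z ^ (4 * m) * eval_fps F (nome z)) ^ 3"
      using G_Delta[OF norm_nome_less_1[OF Im_minus_inverse_pos[OF z]]] modular_fpsD(2)[OF F z] by simp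
    also have "\<dots> = (z ^ 12 * Delta (nome z)) ^ m * G (nome z)"
      using G_Delta[OF norm_nome_less_1[OF z]]
      by (simp add: power_mult_distrib power_mult [symmetric] mult_ac)
    also have "\<dots> = G (nome z) * Delta (nome (- 1 / z)) ^ m"
      unfolding Delta_transformation[OF z] by (rule mult.commute)
    finally show ?thesis using mult_right_cancel[OF nz] by blast
  qed
  \<comment> \<open>By the reduction, the maximum over this small disc is a maximum over the whole
    unit disc, attained at an interior point.\<close>
  have "continuous_on (cball 0 (exp (- pi))) G"
    by (intro holomorphic_on_imp_continuous_on holomorphic_on_subset[OF G_holo] cball_exp_minus_pi_subset)
  then obtain q0 where q0: "norm q0 \<le> exp (- pi)" "\<And>q. norm q \<le> exp (- pi) \<Longrightarrow> norm (G q) \<le> norm (G q0)"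
    by (rule norm_attains_max) auto
  have q0': "norm q0 < 1" using q0(1) by (rule le_less_trans) simp
  have le: "norm (G (nome z)) \<le> norm (G q0)" if "Im z > 0" for z
    using that
  proof (induction z rule: upper_half_plane_induct)
    case (high z)
    then show ?case by (intro q0(2) norm_nome_le)
  next
    case (invert z)
    then show ?case using G_inv[of z] by simp
  qed simp
  have "norm (G q) \<le> norm (G q0)" if "norm q < 1" for q
  proof (cases "q = 0")
    case True
    then show ?thesis using q0(2)[of 0] by simp
  next
    case False
    with that obtain z where "Im z > 0" "nome z = q" using nome_eqE by blast
    with le show ?thesis by blast
  qed
  then have "G constant_on ball 0 1"
    using q0' by (intro maximum_modulus_principle[OF G_holo _ _ open_ball order_refl]) auto
  then obtain c where c: "\<And>q. q \<in> ball 0 1 \<Longrightarrow> G q = c" unfolding constant_on_def by blast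
  moreover have "G 0 = 0" using e by (simp add: G_def)
  ultimately have G0: "G q = 0" if "norm q < 1" for q
    using that c[of 0] c[of q] by simp
  have "eval_fps F q = 0" if "norm q < 1" for q
    using G_Delta[OF that] G0[OF that] by simp
  then have "eventually (\<lambda>q. eval_fps F q = eval_fps 0 q) (nhds 0)"
    by (auto simp: eventually_nhds intro!: exI[of _ "ball 0 1"])
  moreover have "fps_conv_radius F > 0" using rad by (rule fps_conv_radius_pos)
  ultimately show ?thesis by (intro eval_fps_eqD) auto
qed

section \<open>Size and sign of cusp form coefficients\<close>

lemma power_le_fact_mult_exp:
  fixes y :: real
  assumes "y \<ge> 0"
  shows "y ^ n \<le> fact n * exp y"
proof -
  have "sum (\<lambda>k. y ^ k /\<^sub>R fact k) {n} \<le> exp y"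
    unfolding exp_def using assms by (intro sum_le_suminf summable_exp_generic) auto
  then show ?thesis by (simp add: field_simps)
qed

text \<open>The vanishing constant term splits off one factor q, which supplies the exponential; the
  other factor is bounded on the compact disc.\<close>

lemma cusp_form_decay:
  fixes F :: "complex fps"
  assumes rad: "fps_conv_radius F \<ge> 1" and "fps_nth F 0 = 0"
  obtains C where "C \<ge> 0" "\<And>z. Im z \<ge> 1 / 2 \<Longrightarrow> norm (eval_fps F (nome z)) \<le> C * exp (- 2 * pi * Im z)"
proof -
  have F1: "eval_fps F q = q ^ 1 * eval_fps (fps_shift 1 F) q" if "norm q < 1" for q
    using assms that by (intro eval_fps_shift_zero) auto
  have "continuous_on (cball 0 (exp (- pi))) (eval_fps (fps_shift 1 F))"
    by (intro holomorphic_on_imp_continuous_on cball_exp_minus_pi_subset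
              holomorphic_on_subset[OF eval_fps_holomorphic_unit_ball]) (use rad in auto)
  then obtain q0 where q0: "\<And>q. norm q \<le> exp (- pi) \<Longrightarrow>
      norm (eval_fps (fps_shift 1 F) q) \<le> norm (eval_fps (fps_shift 1 F) q0)"
    by (rule norm_attains_max) auto
  show ?thesis
  proof (rule that)
    fix z assume z: "Im z \<ge> 1 / 2"
    have "norm (eval_fps F (nome z)) = norm (eval_fps (fps_shift 1 F) (nome z)) * exp (- 2 * pi * Im z)"
      using F1[OF norm_nome_less_1[of z]] z by (simp add: norm_mult norm_nome)
    also have "\<dots> \<le> norm (eval_fps (fps_shift 1 F) q0) * exp (- 2 * pi * Im z)"
      by (intro mult_right_mono q0 norm_nome_le z) auto
    finally show "norm (eval_fps F (nome z)) \<le> norm (eval_fps (fps_shift 1 F) q0) * exp (- 2 * pi * Im z)" .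
  qed auto
qed

text \<open>|f(z)| Im(z)^(k/2), with k / 2 = 2 m, is unchanged by translation and inversion, hence
  bounded on the whole half plane. Cauchy's estimate at height 1 / n then bounds the
  coefficient.\<close>

theorem Hecke_bound:
  assumes F: "modular_fps (4 * m) F" "fps_nth F 0 = 0"
  obtains C where "\<And>n. n \<ge> 1 \<Longrightarrow> norm (fps_nth F n) \<le> C * real n ^ (2 * m)"
proof -
  note rad = modular_fpsD(1)[OF F(1)]
  obtain C where C: "C \<ge> 0" "\<And>z. Im z \<ge> 1 / 2 \<Longrightarrow> norm (eval_fps F (nome z)) \<le> C * exp (- 2 * pi * Im z)"
    using cusp_form_decay[OF rad F(2)] by blast
  \<comment> \<open>For y = Im z >= 1/2, the power y^(2m) is at most (2m)! exp y, which the decay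
    exp (-2 pi y) absorbs.\<close>
  define B where "B = C * fact (2 * m)"
  have bound: "norm (eval_fps F (nome z)) * Im z ^ (2 * m) \<le> B" if "Im z > 0" for z
    using that
  proof (induction z rule: upper_half_plane_induct)
    case (high z)
    have "norm (eval_fps F (nome z)) * Im z ^ (2 * m) \<le>
            C * exp (- 2 * pi * Im z) * (fact (2 * m) * exp (Im z))"
      using high C by (intro mult_mono power_le_fact_mult_exp) auto
    also have "\<dots> = B * exp (Im z * (1 - 2 * pi))"
      by (simp add: B_def exp_add [symmetric] algebra_simps)
    also have "\<dots> \<le> B * 1"
      using C(1) high pi_gt3 by (intro mult_left_mono) (auto simp: B_def mult_nonneg_nonpos)
    finally show ?case by simp
  next
    case (invert z)
    have nz: "norm z > 0" using invert(1) by auto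
    have "norm (eval_fps F (nome (- 1 / z))) * Im (- 1 / z) ^ (2 * m) =
            norm z ^ (4 * m) * norm (eval_fps F (nome z)) * (Im z ^ (2 * m) / norm z ^ (4 * m))"
      unfolding Im_minus_inverse modular_fpsD(2)[OF F(1) invert(1)]
      by (simp add: norm_mult norm_power power_divide power_mult [symmetric])
    also have "\<dots> = norm (eval_fps F (nome z)) * Im z ^ (2 * m)"
      using nz by simp
    finally show ?case using invert(2) by simp
  qed simp
  show ?thesis
  proof (rule that)
    fix n :: nat assume n: "n \<ge> 1"
    \<comment> \<open>The circle of radius r consists of nomes at height 1 / n, and r ^ n is then
      independent of n.\<close>
    define r where "r = exp (- 2 * pi / real n)"
    have r: "r > 0" "r < 1" using n by (auto simp: r_def)
    have "norm ((deriv ^^ n) (eval_fps F) 0) \<le> fact n * (B * real n ^ (2 * m)) / r ^ n"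
    proof (rule Cauchy_inequality)
      have "eval_fps F holomorphic_on ball 0 1" by (rule eval_fps_holomorphic_unit_ball[OF rad])
      then have "eval_fps F holomorphic_on cball 0 r"
        by (rule holomorphic_on_subset) (use r in auto)
      then show "eval_fps F holomorphic_on ball 0 r" "continuous_on (cball 0 r) (eval_fps F)"
        by (auto intro: holomorphic_on_subset holomorphic_on_imp_continuous_on)
      fix q :: complex assume "norm (0 - q) = r"
      then have q: "norm q = r" by simp
      with r have "norm q < 1" "q \<noteq> 0" by auto
      then obtain z where z: "Im z > 0" "nome z = q" by (rule nome_eqE)
      have "exp (- 2 * pi * Im z) = exp (- 2 * pi / real n)"
        using norm_nome[of z] z q by (simp add: r_def)
      then have "(2 * pi) * Im z = (2 * pi) * (1 / real n)" by simp
      then have Im_z: "Im z = 1 / real n" by (subst (asm) mult_left_cancel) auto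
      have "norm (eval_fps F q) * (1 / real n) ^ (2 * m) \<le> B"
        using bound[OF z(1)] unfolding z(2) Im_z .
      then show "norm (eval_fps F q) \<le> B * real n ^ (2 * m)"
        using n by (simp add: power_divide divide_le_eq)
    qed (use r in auto)
    also have "r ^ n = exp (- 2 * pi)"
      using n by (simp add: r_def exp_of_nat_mult [symmetric])
    finally have "norm ((deriv ^^ n) (eval_fps F) 0) / fact n \<le> B * real n ^ (2 * m) / exp (- 2 * pi)"
      by (simp add: field_simps)
    also have "norm ((deriv ^^ n) (eval_fps F) 0) / fact n = norm ((deriv ^^ n) (eval_fps F) 0 / fact n)"
      by (simp add: norm_divide)
    also have "(deriv ^^ n) (eval_fps F) 0 / fact n = fps_nth F n"
      by (intro fps_nth_conv_deriv [symmetric] fps_conv_radius_pos rad)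
    also have "B * real n ^ (2 * m) / exp (- 2 * pi) = (B * exp (2 * pi)) * real n ^ (2 * m)"
      by (simp add: exp_minus field_simps)
    finally show "norm (fps_nth F n) \<le> (B * exp (2 * pi)) * real n ^ (2 * m)" .
  qed
qed

text \<open>Along the imaginary axis a cusp form tends to 0 as \<open>t \<rightarrow> 0\<close>, while nonnegative coefficients
  would make it at least as large as each of its terms.\<close>
theorem nonneg_cusp_form_eq_0:
  fixes c :: "nat \<Rightarrow> real"
  assumes F: "modular_fps (4 * m) (Abs_fps (\<lambda>n. of_real (c n)))" and "c 0 = 0"
    and nonneg: "\<And>n. c n \<ge> 0"
  shows "c n = 0"
proof -
  define F where "F = Abs_fps (\<lambda>n. complex_of_real (c n))"
  note F = F[folded F_def]
  note rad = modular_fpsD(1)[OF F]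
  obtain C where C: "C \<ge> 0" "\<And>z. Im z \<ge> 1 / 2 \<Longrightarrow> norm (eval_fps F (nome z)) \<le> C * exp (- 2 * pi * Im z)"
    using cusp_form_decay[OF rad] assms(2) by (auto simp: F_def)
  have ineq: "c n * exp (- 2 * pi * real n / real N) \<le> C * (fact (4 * m) * exp (- real N))" if N: "N \<ge> 1" for N
  proof -
    \<comment> \<open>Inversion sends i / N to i N, where the form is O(exp (-2 pi N)). The factor
      N^(4m) costs at most (4m)! exp N, and 1 - 2 pi <= -1 leaves exp (-N).\<close>
    define z where "z = \<i> * of_real (1 / real N)"
    define q where "q = exp (- 2 * pi / real N)"
    have Im_z: "Im z = 1 / real N" by (simp add: z_def)
    then have z: "Im z > 0" using N by simp
    have inv: "- 1 / z = \<i> * of_real (real N)"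
      using N by (simp add: z_def field_simps)
    have q: "0 < q" "q < 1" using N by (auto simp: q_def)
    have nome_z: "nome z = of_real q"
    proof -
      have "2 * of_real pi * \<i> * z = of_real (- 2 * pi / real N)" by (simp add: z_def mult_ac)
      then show ?thesis unfolding nome_def q_def by (simp only: exp_of_real)
    qed
    have *: "ereal (norm (nome z)) < conv_radius (fps_nth F)"
      using modular_fpsD(3)[OF F norm_nome_less_1[OF z]] by (simp add: fps_conv_radius_def)
    have "summable (\<lambda>n. norm (fps_nth F n * nome z ^ n))"
      by (rule abs_summable_in_conv_radius[OF *])
    then have summ: "summable (\<lambda>n. c n * q ^ n)"
      using nonneg q by (simp add: F_def nome_z norm_mult norm_power)
    have "c n * q ^ n = sum (\<lambda>n. c n * q ^ n) {n}" by simp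
    also have "\<dots> \<le> (\<Sum>n. c n * q ^ n)"
      by (rule sum_le_suminf[OF summ]) (use nonneg q in auto)
    also have "eval_fps F (nome z) = of_real (\<Sum>n. c n * q ^ n)"
      by (simp add: eval_fps_def F_def nome_z suminf_of_real [OF summ])
    then have "(\<Sum>n. c n * q ^ n) \<le> norm (eval_fps F (nome z))" by simp
    also have "eval_fps F (nome (\<i> * of_real (real N))) = z ^ (4 * m) * eval_fps F (nome z)"
      using modular_fpsD(2)[OF F z] unfolding inv .
    then have "norm (eval_fps F (nome (\<i> * of_real (real N)))) = norm (eval_fps F (nome z)) / real N ^ (4 * m)"
      by (simp add: norm_mult norm_power z_def power_divide norm_divide)
    then have "norm (eval_fps F (nome z)) = real N ^ (4 * m) * norm (eval_fps F (nome (\<i> * of_real (real N))))"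
      using N by simp
    also have "\<dots> \<le> (fact (4 * m) * exp (real N)) * (C * exp (- 2 * pi * real N))"
      using C(2)[of "\<i> * of_real (real N)"] N by (intro mult_mono power_le_fact_mult_exp) auto
    also have "\<dots> = C * (fact (4 * m) * (exp (real N) * exp (- 2 * pi * real N)))"
      by (simp only: mult_ac)
    also have "exp (real N) * exp (- 2 * pi * real N) = exp (real N * (1 - 2 * pi))"
      by (simp add: exp_add [symmetric] algebra_simps)
    also have "C * (fact (4 * m) * exp (real N * (1 - 2 * pi))) \<le> C * (fact (4 * m) * exp (real N * (- 1)))"
      using C(1) pi_gt3 by (intro mult_left_mono exp_le_cancel_iff[THEN iffD2]) auto
    also have "q ^ n = exp (- 2 * pi * real n / real N)"
      by (simp add: q_def exp_of_nat_mult [symmetric] mult_ac)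
    finally show ?thesis by simp
  qed
  \<comment> \<open>As N grows, the left side of \<open>ineq\<close> tends to c n and the right side
    to 0.\<close>
  have "(\<lambda>N. c n * exp (- 2 * pi * real n * (1 / real N))) \<longlonglongrightarrow> c n * exp (- 2 * pi * real n * 0)"
    by (intro tendsto_intros lim_1_over_n)
  moreover have "(\<lambda>N. C * (fact (4 * m) * exp (- real N))) \<longlonglongrightarrow> C * (fact (4 * m) * 0)"
    by (intro tendsto_intros filterlim_compose[OF exp_at_bot] filterlim_compose[OF filterlim_uminus_at_bot_at_top]
          filterlim_real_sequentially)
  ultimately have "c n * exp (- 2 * pi * real n * 0) \<le> C * (fact (4 * m) * 0)"
    by (rule LIMSEQ_le) (use ineq in \<open>auto intro!: exI[of _ 1]\<close>)
  then show ?thesis using nonneg[of n] by simp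
qed

text \<open>The conjugate of f(-cnj z) has the conjugate coefficients. The reflection commutes with
  inversion and turns the automorphy factor into (-z)^k, so an even weight preserves it.\<close>

lemma modular_fps_cnj:
  assumes F: "modular_fps k F" and "even k"
  shows "modular_fps k (Abs_fps (\<lambda>n. cnj (fps_nth F n)))"
proof -
  define G where "G = Abs_fps (\<lambda>n. cnj (fps_nth F n))"
  have rad: "fps_conv_radius G = fps_conv_radius F"
    unfolding fps_conv_radius_def G_def by (simp add: conv_radius_def)
  have eval: "eval_fps G q = cnj (eval_fps F (cnj q))" if q: "norm q < 1" for q
  proof -
    have "ereal (norm (cnj q)) < fps_conv_radius F" using modular_fpsD(3)[OF F, of "cnj q"] q by simp
    then have "(\<lambda>n. fps_nth F n * cnj q ^ n) sums eval_fps F (cnj q)" by (rule sums_eval_fps)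
    then have "(\<lambda>n. cnj (fps_nth F n * cnj q ^ n)) sums cnj (eval_fps F (cnj q))"
      by (simp only: sums_cnj)
    then show ?thesis by (simp add: eval_fps_def G_def sums_iff)
  qed
  have nome_cnj: "cnj (nome z) = nome (- cnj z)" for z
    by (simp add: nome_def exp_cnj)
  have "eval_fps G (nome (- 1 / z)) = z ^ k * eval_fps G (nome z)" if z: "Im z > 0" for z
  proof -
    define w where "w = - cnj z"
    have w: "Im w > 0" using z by (simp add: w_def)
    have inv: "- cnj (- 1 / z) = - 1 / w" by (simp add: w_def)
    have "eval_fps G (nome (- 1 / z)) = cnj (eval_fps F (nome (- 1 / w)))"
      using eval[OF norm_nome_less_1[OF Im_minus_inverse_pos[OF z]]] unfolding nome_cnj inv .
    also have "\<dots> = cnj w ^ k * cnj (eval_fps F (nome w))"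
      unfolding modular_fpsD(2)[OF F w] by simp
    also have "cnj w ^ k = z ^ k" using assms(2) by (simp add: w_def)
    also have "cnj (eval_fps F (nome w)) = eval_fps G (nome z)"
      using eval[OF norm_nome_less_1[OF z]] unfolding nome_cnj w_def[symmetric] by simp
    finally show ?thesis .
  qed
  then show ?thesis unfolding G_def[symmetric] using F by (simp add: modular_fps_def rad)
qed

text \<open>Supplies real forms without inspecting the coefficients of \<open>U\<close>.\<close>

lemma modular_fps_Re:
  assumes F: "modular_fps k F" and "even k"
  shows "modular_fps k (Abs_fps (\<lambda>n. of_real (Re (fps_nth F n))))"
proof -
  have "modular_fps (0 + k) (fps_const (1 / 2) * (F + Abs_fps (\<lambda>n. cnj (fps_nth F n))))"
    by (intro modular_fps_mult modular_fps_add modular_fps_const F modular_fps_cnj assms)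
  also have "fps_const (1 / 2) * (F + Abs_fps (\<lambda>n. cnj (fps_nth F n))) = Abs_fps (\<lambda>n. of_real (Re (fps_nth F n)))"
    by (rule fps_ext) (simp add: complex_add_cnj)
  finally show ?thesis by simp
qed

section \<open>The polytope\<close>

lemma modformR_iff: "c \<in> modformR k \<longleftrightarrow> modular_fps k (Abs_fps (\<lambda>n. of_real (c n)))"
  by (simp add: modformR_def modform_iff_modular_fps)

lemma modformR_lincomb:
  assumes "c \<in> modformR k" "d \<in> modformR k"
  shows "(\<lambda>n. c n + t * d n) \<in> modformR k"
proof -
  have "modular_fps (0 + k) (fps_const (of_real t) * Abs_fps (\<lambda>n. of_real (d n)))"
    using assms(2) unfolding modformR_iff by (intro modular_fps_mult modular_fps_const)
  with assms(1) have "modular_fps k (Abs_fps (\<lambda>n. of_real (c n)) + fps_const (of_real t) * Abs_fps (\<lambda>n. of_real (d n)))"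
    unfolding modformR_iff by (intro modular_fps_add) simp_all
  also have "Abs_fps (\<lambda>n. of_real (c n)) + fps_const (of_real t) * Abs_fps (\<lambda>n. of_real (d n)) =
               (Abs_fps (\<lambda>n. of_real (c n + t * d n)) :: complex fps)"
    by (rule fps_ext) simp
  finally show ?thesis unfolding modformR_iff .
qed

lemma modformR_0: "(\<lambda>n. 0) \<in> modformR k"
proof -
  have "Abs_fps (\<lambda>n. 0) = (0 :: complex fps)" by (rule fps_ext) simp
  then show ?thesis by (simp add: modformR_iff modular_fps_def)
qed

lemma modformR_sum:
  assumes "finite A" "\<And>r. r \<in> A \<Longrightarrow> f r \<in> modformR k"
  shows "(\<lambda>n. \<Sum>r\<in>A. a r * f r n) \<in> modformR k"
  using assms
proof (induction A rule: finite_induct)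
  case empty
  show ?case using modformR_0 by simp
next
  case (insert x A)
  have "(\<lambda>n. (\<Sum>r\<in>A. a r * f r n) + a x * f x n) \<in> modformR k"
    by (intro modformR_lincomb insert) (use insert in auto)
  then show ?case using insert by (simp add: add.commute)
qed

section \<open>Forms with prescribed leading coefficients\<close>

lemma modformR_eqI:
  assumes "c \<in> modformR (4 * m)" "d \<in> modformR (4 * m)" "\<And>j. j \<le> m div 3 \<Longrightarrow> c j = d j"
  shows "c = d"
proof -
  have "(\<lambda>n. c n + (- 1) * d n) \<in> modformR (4 * m)" by (rule modformR_lincomb[OF assms(1,2)])
  then have "Abs_fps (\<lambda>n. complex_of_real (c n + (- 1) * d n)) = 0"
    unfolding modformR_iff by (rule modular_fps_eq_0) (use assms(3) in auto)
  then have "fps_nth (Abs_fps (\<lambda>n. complex_of_real (c n + (- 1) * d n))) n = 0" for n by simp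
  then have "c n - d n = 0" for n by (simp del: of_real_diff of_real_add add: of_real_eq_0_iff)
  then show ?thesis by (simp add: fun_eq_iff)
qed

lemma modformR_basis:
  assumes "j \<le> m div 3"
  obtains c where "c \<in> modformR (4 * m)" "c j = 1" "\<And>i. i < j \<Longrightarrow> c i = 0"
proof -
  obtain \<kappa> :: real where E: "modular_fps 4 (1 + fps_const (of_real \<kappa>) * sigma_fps 3)" (is "modular_fps 4 ?E")
    using modular_fps_E4 by blast
  obtain U where U: "fps_nth U 0 = 1" "modular_fps 12 (fps_X * U)"
    using modular_fps_Delta by blast
  \<comment> \<open>The bound on j keeps m - 3 j from truncating, so the weights 4 (m - 3 j) and 12
    j add up to 4 m.\<close>
  define B where "B = ?E ^ (m - 3 * j) * (fps_X * U) ^ j"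
  have "modular_fps (4 * (m - 3 * j) + 12 * j) B"
    unfolding B_def by (intro modular_fps_mult modular_fps_power E U)
  also have "4 * (m - 3 * j) + 12 * j = 4 * m" using assms by linarith
  finally have "(\<lambda>n. Re (fps_nth B n)) \<in> modformR (4 * m)"
    unfolding modformR_iff by (rule modular_fps_Re) simp
  moreover have "B = fps_X ^ j * (?E ^ (m - 3 * j) * U ^ j)"
    by (simp add: B_def power_mult_distrib mult_ac)
  then have "fps_nth B n = (if n < j then 0 else fps_nth (?E ^ (m - 3 * j) * U ^ j) (n - j))" for n
    by (simp only: fps_X_power_mult_nth)
  then have "fps_nth B j = 1" "\<And>i. i < j \<Longrightarrow> fps_nth B i = 0"
    using U(1) by (simp_all add: fps_power_zeroth)
  ultimately show ?thesis using that by simp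
qed

text \<open>Triangular elimination: a multiple of the i-th basis form corrects coefficient i and
  leaves the earlier ones alone.\<close>

lemma modformR_exists:
  obtains c where "c \<in> modformR (4 * m)" "\<And>j. j \<le> m div 3 \<Longrightarrow> c j = t j"
proof -
  have "\<exists>c \<in> modformR (4 * m). \<forall>j<i. c j = t j" if "i \<le> Suc (m div 3)" for i
    using that
  proof (induction i)
    case 0
    then show ?case using modformR_0 by blast
  next
    case (Suc i)
    then obtain c where c: "c \<in> modformR (4 * m)" "\<forall>j<i. c j = t j" by auto
    obtain b where b: "b \<in> modformR (4 * m)" "b i = 1" "\<And>j. j < i \<Longrightarrow> b j = 0"
      using modformR_basis[of i m] Suc.prems by auto
    have "(\<lambda>n. c n + (t i - c i) * b n) \<in> modformR (4 * m)"
      by (intro modformR_lincomb c b)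
    moreover have "\<forall>j<Suc i. c j + (t i - c i) * b j = t j"
      using c b by (auto simp: less_Suc_eq)
    ultimately show ?case by (intro bexI[where x = "\<lambda>n. c n + (t i - c i) * b n"])
  qed
  from this[of "Suc (m div 3)"]
  obtain c where "c \<in> modformR (4 * m)" "\<forall>j<Suc (m div 3). c j = t j" by blast
  then show ?thesis by (intro that[of c]) simp_all
qed

lemma
  shows Fkr_modformR: "Fkr (4 * m) r \<in> modformR (4 * m)"
    and Fkr_nth: "j \<le> m div 3 \<Longrightarrow> Fkr (4 * m) r j = (if j = r then 1 else 0)"
proof -
  define P where "P = (\<lambda>c. c \<in> modformR (4 * m) \<and> (\<forall>j \<le> m div 3. c j = (if j = r then 1 else 0 :: real)))"
  have "\<exists>!c. P c"
  proof (rule ex_ex1I)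
    show "\<exists>c. P c" unfolding P_def by (rule modformR_exists[of m "\<lambda>j. if j = r then 1 else 0"]) auto
    show "c = d" if "P c" "P d" for c d
      by (rule modformR_eqI[of c m d]) (use that in \<open>auto simp: P_def\<close>)
  qed
  then have "P (THE c. P c)" by (rule theI')
  moreover have "Fkr (4 * m) r = (THE c. P c)"
    by (simp add: Fkr_def P_def)
  ultimately show "Fkr (4 * m) r \<in> modformR (4 * m)"
    and "j \<le> m div 3 \<Longrightarrow> Fkr (4 * m) r j = (if j = r then 1 else 0)"
    by (simp_all add: P_def)
qed

lemma modformR_expand:
  assumes "c \<in> modformR (4 * m)"
  shows "c n = c 0 * Fkr (4 * m) 0 n + (\<Sum>r = 1..m div 3. c r * Fkr (4 * m) r n)"
proof -
  have "(\<lambda>n. (\<Sum>r = 1..m div 3. c r * Fkr (4 * m) r n) + c 0 * Fkr (4 * m) 0 n) \<in> modformR (4 * m)"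
    by (intro modformR_lincomb modformR_sum Fkr_modformR) auto
  then have "c = (\<lambda>n. (\<Sum>r = 1..m div 3. c r * Fkr (4 * m) r n) + c 0 * Fkr (4 * m) 0 n)"
  proof (rule modformR_eqI[OF assms])
    fix j assume "j \<le> m div 3"
    then show "c j = (\<Sum>r = 1..m div 3. c r * Fkr (4 * m) r j) + c 0 * Fkr (4 * m) 0 j"
      by (cases "j = 0") (auto simp: Fkr_nth if_distrib cong: if_cong)
  qed
  then show ?thesis by (metis add.commute)
qed

section \<open>Growth of the powers of E4\<close>

lemma fps_power_E4_growth:
  fixes F :: "complex fps"
  assumes F0: "fps_nth F 0 = 1" and \<kappa>: "\<kappa> > 0"
    and F: "\<And>n. n > 0 \<Longrightarrow> \<exists>x. fps_nth F n = of_real x \<and> x \<ge> \<kappa> * real n ^ 3"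
  shows "\<exists>c>0. \<forall>n. \<exists>x. fps_nth (F ^ Suc m) n = of_real x \<and> x \<ge> c * real n ^ (3 * Suc m)"
proof (induction m)
  \<comment> \<open>The induction starts at the first power, as the zeroth power has no positive
    coefficients beyond the constant term.\<close>
  case 0
  have "\<exists>x. fps_nth F n = of_real x \<and> x \<ge> \<kappa> * real n ^ 3" for n
    using F F0 by (cases "n = 0") (auto intro: exI[of _ 1])
  then show ?case using \<kappa> by auto
next
  case (Suc m)
  then obtain c x where c: "c > 0" and x: "\<And>n. fps_nth (F ^ Suc m) n = of_real (x n)"
      "\<And>n. x n \<ge> c * real n ^ (3 * Suc m)"
    by metis
  have "\<exists>y. fps_nth F n = of_real y \<and> y \<ge> 0 \<and> (n > 0 \<longrightarrow> y \<ge> \<kappa> * real n ^ 3)" for n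
  proof (cases "n = 0")
    case False
    then obtain y where y: "fps_nth F n = of_real y" "y \<ge> \<kappa> * real n ^ 3" using F by blast
    moreover have "\<kappa> * real n ^ 3 \<ge> 0" using \<kappa> by simp
    ultimately show ?thesis by (intro exI[of _ y]) auto
  qed (use F0 in \<open>auto intro: exI[of _ 1]\<close>)
  then obtain y where y: "\<And>n. fps_nth F n = of_real (y n)" "\<And>n. y n \<ge> 0"
      "\<And>n. n > 0 \<Longrightarrow> y n \<ge> \<kappa> * real n ^ 3"
    by metis
  have y0: "y 0 = 1" using y(1)[of 0] F0 by simp
  have x_nonneg: "x n \<ge> 0" for n
    using x(2)[of n] c by (meson order_trans mult_nonneg_nonneg less_imp_le zero_le_power of_nat_0_le_iff)
  \<comment> \<open>All convolution terms are nonnegative, so the one at j = n div 2 suffices. For n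
    >= 2 one has j >= n / 4 and n - j >= n / 2; for n = 1 the constant term 1 takes over, whence
    \<open>min 1 \<kappa>\<close>.\<close>
  define C where "C = min 1 \<kappa> * (1 / 4) ^ 3 * (c * (1 / 2) ^ (3 * Suc m))"
  have "C > 0" using c \<kappa> by (simp add: C_def)
  moreover have "\<exists>w. fps_nth (F ^ Suc (Suc m)) n = of_real w \<and> w \<ge> C * real n ^ (3 * Suc (Suc m))" for n
  proof -
    define w where "w = (\<Sum>i=0..n. y i * x (n - i))"
    have "fps_nth (F ^ Suc (Suc m)) n = fps_nth (F * F ^ Suc m) n" by simp
    also have "\<dots> = of_real w" unfolding fps_mult_nth w_def by (simp add: y x del: power_Suc)
    finally have eq: "fps_nth (F ^ Suc (Suc m)) n = of_real w" .
    define j where "j = n div 2"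
    have w_ge: "w \<ge> y j * x (n - j)"
      unfolding w_def by (rule member_le_sum) (use x_nonneg y in \<open>auto simp: j_def\<close>)
    have y_ge: "y j \<ge> min 1 \<kappa> * (1 / 4 * real n) ^ 3" if "n > 0"
    proof (cases "j = 0")
      case True
      then have "n = 1" using that by (simp add: j_def)
      have "min 1 \<kappa> * (1 / 4 * real n) ^ 3 \<le> 1 * 1"
        using \<open>n = 1\<close> \<kappa> by (intro mult_mono) (auto simp: power_le_one)
      then show ?thesis using y0 True by simp
    next
      case False
      have "real n \<le> 4 * real j" using False unfolding j_def by linarith
      then have "(1 / 4 * real n) ^ 3 \<le> real j ^ 3" by (intro power_mono) auto
      then have "min 1 \<kappa> * (1 / 4 * real n) ^ 3 \<le> \<kappa> * real j ^ 3"
        using \<kappa> by (intro mult_mono) auto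
      then show ?thesis using y(3)[of j] False by simp
    qed
    have x_ge: "x (n - j) \<ge> c * (1 / 2 * real n) ^ (3 * Suc m)"
    proof -
      have "1 / 2 * real n \<le> real (n - j)" unfolding j_def by linarith
      then have "c * (1 / 2 * real n) ^ (3 * Suc m) \<le> c * real (n - j) ^ (3 * Suc m)"
        using c by (intro mult_left_mono power_mono) auto
      then show ?thesis using x(2)[of "n - j"] by linarith
    qed
    have "w \<ge> C * real n ^ (3 * Suc (Suc m))"
    proof (cases "n = 0")
      case True
      then show ?thesis using w_ge mult_nonneg_nonneg[OF y(2) x_nonneg, of j "n - j"]
        by (simp add: power_0_left)
    next
      case False
      have "C * real n ^ (3 * Suc (Suc m)) = (min 1 \<kappa> * (1 / 4 * real n) ^ 3) * (c * (1 / 2 * real n) ^ (3 * Suc m))"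
        unfolding C_def power_mult_distrib by (simp add: power_add [symmetric] mult_ac)
      also have "\<dots> \<le> y j * x (n - j)"
        using y_ge x_ge False c \<kappa> y by (intro mult_mono) auto
      finally show ?thesis using w_ge by linarith
    qed
    with eq show ?thesis by blast
  qed
  ultimately show ?case by blast
qed

lemma modformR_dominating:
  assumes "m \<ge> 1"
  obtains e \<gamma> where "e \<in> modformR (4 * m)" "e 0 = 1" "\<gamma> > 0" "\<And>n. e n \<ge> \<gamma> * real n ^ (3 * m)"
proof -
  obtain \<kappa> :: real where \<kappa>: "\<kappa> > 0" and E: "modular_fps 4 (1 + fps_const (of_real \<kappa>) * sigma_fps 3)" (is "modular_fps 4 ?E")
    using modular_fps_E4 by blast
  obtain m' where m: "m = Suc m'" using assms by (cases m) auto
  have E0: "fps_nth ?E 0 = 1" by simp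
  have "\<exists>x. fps_nth ?E n = of_real x \<and> x \<ge> \<kappa> * real n ^ 3" if "n > 0" for n
  proof -
    have "real n ^ 3 \<le> real (divisor_sum 3 n)" using divisor_sum_ge[OF that, of 3] by (metis of_nat_le_iff of_nat_power)
    then show ?thesis using \<kappa> that by (intro exI[of _ "\<kappa> * real (divisor_sum 3 n)"]) auto
  qed
  from fps_power_E4_growth[OF E0 \<kappa> this, of m']
  obtain \<gamma> where \<gamma>: "\<gamma> > 0" "\<And>n. \<exists>x. fps_nth (?E ^ m) n = of_real x \<and> x \<ge> \<gamma> * real n ^ (3 * m)"
    unfolding m by blast
  show ?thesis
  proof (rule that)
    show "(\<lambda>n. Re (fps_nth (?E ^ m) n)) \<in> modformR (4 * m)"
      unfolding modformR_iff by (intro modular_fps_Re modular_fps_power E) simp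
    show "Re (fps_nth (?E ^ m) 0) = 1" by (simp add: fps_power_zeroth)
    fix n show "Re (fps_nth (?E ^ m) n) \<ge> \<gamma> * real n ^ (3 * m)"
      using \<gamma>(2)[of n] by auto
  qed (rule \<gamma>(1))
qed

section \<open>Compactness and the uniform margin\<close>

lemma compact_coordinate_sphere:
  "compact {a. (\<forall>r. \<bar>a r :: real\<bar> \<le> (if r \<in> I then 1 else 0)) \<and> (\<exists>r\<in>I. \<bar>a r\<bar> = 1)}"
  if "finite I" for I :: "nat set"
proof -
  \<comment> \<open>The sup-norm sphere sits in a product of compact factors, trivial outside I, and
    Tychonoff's theorem applies.\<close>
  define S where "S = (\<lambda>r. if r \<in> I then {-1..1 :: real} else {0})"
  have "compactin (product_topology (\<lambda>_. euclidean) UNIV) (PiE UNIV S)"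
    unfolding compactin_PiE by (auto simp: S_def)
  then have "compact (PiE UNIV S)"
    by (simp add: euclidean_product_topology)
  moreover have "closed (\<Union>r\<in>I. {a :: nat \<Rightarrow> real. \<bar>a r\<bar> = 1})"
    by (intro closed_UN that ballI closed_Collect_eq continuous_on_rabs continuous_on_product_coordinates continuous_on_const)
  ultimately have "compact (PiE UNIV S \<inter> (\<Union>r\<in>I. {a :: nat \<Rightarrow> real. \<bar>a r\<bar> = 1}))"
    by (rule compact_Int_closed)
  also have "PiE UNIV S \<inter> (\<Union>r\<in>I. {a :: nat \<Rightarrow> real. \<bar>a r\<bar> = 1}) =
     {a. (\<forall>r. \<bar>a r :: real\<bar> \<le> (if r \<in> I then 1 else 0)) \<and> (\<exists>r\<in>I. \<bar>a r\<bar> = 1)}"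
    by (auto simp: S_def PiE_def Pi_def abs_le_iff split: if_splits) (smt (verit))+
  finally show ?thesis .
qed

text \<open>The sets \<open>U j\<close> form an open cover of the unit sphere by hypothesis; a
  finite subcover bounds the index from above and the margin away from 0. Homogeneity extends this
  to all a, with every |a r| below the sup norm.\<close>

lemma uniform_negativity:
  fixes v :: "nat \<Rightarrow> nat \<Rightarrow> real"
  assumes neg: "\<And>a. a \<in> Rl l \<Longrightarrow> a \<noteq> (\<lambda>_. 0) \<Longrightarrow> \<exists>n\<ge>1. (\<Sum>r = 1..l. a r * v r n) < 0"
  obtains N \<delta> where "N \<ge> 1" "\<delta> > 0"
    "\<And>a. a \<in> Rl l \<Longrightarrow> a \<noteq> (\<lambda>_. 0) \<Longrightarrow> \<exists>n\<in>{1..N}. \<forall>r. (\<Sum>r = 1..l. a r * v r n) \<le> - \<delta> * \<bar>a r\<bar>"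
proof -
  define K where "K = {a. (\<forall>r. \<bar>a r :: real\<bar> \<le> (if r \<in> {1..l} then 1 else 0)) \<and> (\<exists>r\<in>{1..l}. \<bar>a r\<bar> = 1)}"
  define U where "U = (\<lambda>j. \<Union>n\<in>{1..j}. {a. (\<Sum>r = 1..l. a r * v r n) < - (1 / real (Suc j))})"
  have "compact K" unfolding K_def by (rule compact_coordinate_sphere) simp
  moreover have "open (U j)" for j
    unfolding U_def
    by (intro open_UN ballI open_Collect_less continuous_on_sum continuous_on_mult
              continuous_on_product_coordinates continuous_on_const)
  moreover have "K \<subseteq> (\<Union>j\<in>UNIV. U j)"
  proof
    fix a assume a: "a \<in> K"
    have "a \<in> Rl l"
    proof -
      have "\<bar>a r\<bar> \<le> 0" if "r = 0 \<or> r > l" for r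
        using a that unfolding K_def by (auto dest!: spec[of _ r])
      then show ?thesis by (auto simp: Rl_def)
    qed
    moreover have "a \<noteq> (\<lambda>_. 0)" using a by (auto simp: K_def)
    ultimately obtain n where n: "n \<ge> 1" "(\<Sum>r = 1..l. a r * v r n) < 0" using neg by blast
    obtain j0 where j0: "inverse (real (Suc j0)) < - (\<Sum>r = 1..l. a r * v r n)"
      using reals_Archimedean[of "- (\<Sum>r = 1..l. a r * v r n)"] n by auto
    define j where "j = max n j0"
    have "1 / real (Suc j) \<le> 1 / real (Suc j0)" by (intro divide_left_mono) (auto simp: j_def)
    with j0 have "(\<Sum>r = 1..l. a r * v r n) < - (1 / real (Suc j))" by (simp add: inverse_eq_divide)
    moreover have "n \<in> {1..j}" using n by (auto simp: j_def)
    ultimately show "a \<in> (\<Union>j\<in>UNIV. U j)" unfolding U_def by blast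
  qed
  ultimately obtain J where J: "finite J" "K \<subseteq> (\<Union>j\<in>J. U j)"
    by (rule compactE_image) auto
  define N where "N = Max (insert 1 J)"
  have N: "N \<ge> 1" "\<And>j. j \<in> J \<Longrightarrow> j \<le> N" using J(1) by (auto simp: N_def)
  define \<delta> where "\<delta> = 1 / real (Suc N)"
  have K: "\<exists>n\<in>{1..N}. (\<Sum>r = 1..l. b r * v r n) < - \<delta>" if "b \<in> K" for b
  proof -
    from J(2) that obtain j where "j \<in> J" "b \<in> U j" by blast
    then obtain n where j: "j \<in> J" "n \<in> {1..j}" "(\<Sum>r = 1..l. b r * v r n) < - (1 / real (Suc j))"
      unfolding U_def by auto
    have "1 / real (Suc N) \<le> 1 / real (Suc j)" using N(2)[OF j(1)] by (intro divide_left_mono) auto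
    then show ?thesis using j N(2)[OF j(1)] by (intro bexI[of _ n]) (auto simp: \<delta>_def)
  qed
  show ?thesis
  proof (rule that)
    show "N \<ge> 1" by (rule N)
    show "\<delta> > 0" by (simp add: \<delta>_def)
    fix a assume a: "a \<in> Rl l" "a \<noteq> (\<lambda>_. 0)"
    \<comment> \<open>The sup norm of a; division by it moves a onto the sphere
      \<open>K\<close>.\<close>
    define M where "M = Max ((\<lambda>r. \<bar>a r\<bar>) ` {1..l})"
    obtain r0 where r0: "a r0 \<noteq> 0" using a(2) by auto
    then have r0': "r0 \<in> {1..l}" using a(1) by (cases "r0 = 0 \<or> r0 > l") (auto simp: Rl_def)
    have M_ge: "\<bar>a r\<bar> \<le> M" if "r \<in> {1..l}" for r
      unfolding M_def using that by (intro Max_ge) auto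
    have M: "M > 0" using M_ge[OF r0'] r0 by simp
    have outside: "a r = 0" if "r \<notin> {1..l}" for r
      using a(1) that by (cases "r = 0 \<or> r > l") (auto simp: Rl_def)
    have M_all: "\<bar>a r\<bar> \<le> M" for r
      using M_ge[of r] M outside[of r] by (cases "r \<in> {1..l}") auto
    have "M \<in> (\<lambda>r. \<bar>a r\<bar>) ` {1..l}"
      unfolding M_def using r0' by (intro Max_in) auto
    then obtain r1 where r1: "r1 \<in> {1..l}" "\<bar>a r1\<bar> = M" by auto
    have "(\<lambda>r. a r / M) \<in> K"
      unfolding K_def
    proof (intro CollectI conjI allI)
      fix r show "\<bar>a r / M\<bar> \<le> (if r \<in> {1..l} then 1 else 0)"
        using M M_all[of r] outside[of r] by (cases "r \<in> {1..l}") (auto simp: abs_divide)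
      show "\<exists>r\<in>{1..l}. \<bar>a r / M\<bar> = 1"
        using r1 M by (intro bexI[of _ r1]) auto
    qed
    from K[OF this] obtain n where n: "n \<in> {1..N}" "(\<Sum>r = 1..l. a r / M * v r n) < - \<delta>" by blast
    have "(\<Sum>r = 1..l. a r / M * v r n) = (\<Sum>r = 1..l. a r * v r n) / M"
      by (simp add: sum_divide_distrib)
    with n(2) M have *: "(\<Sum>r = 1..l. a r * v r n) < - \<delta> * M" by (simp add: divide_less_eq)
    have "- \<delta> * M \<le> - \<delta> * \<bar>a r\<bar>" for r
      using M_all[of r] by (simp add: \<delta>_def divide_right_mono)
    then show "\<exists>n\<in>{1..N}. \<forall>r. (\<Sum>r = 1..l. a r * v r n) \<le> - \<delta> * \<bar>a r\<bar>"
      using n(1) * by (intro bexI[of _ n]) (auto intro: order_trans[OF less_imp_le])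
  qed
qed

section \<open>The finite system of inequalities\<close>

theorem theorem5:
  fixes k :: nat
  assumes "k \<ge> 12" and "4 dvd k"
  shows "(\<exists>B. \<forall>a \<in> Sset k. \<forall>r. \<bar>a r\<bar> \<le> B) \<and>
         (\<exists>A :: nat set. finite A \<and> A \<subseteq> {1..} \<and>
             Sset k = (\<Inter>n \<in> A. Sn k n) \<and>
             (\<forall>c \<in> modformR k. c 0 = 1 \<longrightarrow>
                 ((\<forall>n. c n \<ge> 0) \<longleftrightarrow> (\<forall>n \<in> A. c n \<ge> 0))) \<and>
             Ak k \<le> enat (Max A))"
proof -
  obtain m where m: "k = 4 * m" using assms(2) by (elim dvdE)
  have "m \<ge> 3" using assms(1) m by simp
  define l where "l = m div 3"
  have kl: "k div 12 = l" by (simp add: m l_def)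
  note expand = modformR_expand[of _ m, folded m l_def]
  note F_mod = Fkr_modformR[of m, folded m]
  note F_nth = Fkr_nth[of _ m, folded m l_def]
  define G where "G = (\<lambda>a n. Fkr k 0 n + (\<Sum>r = 1..l. a r * Fkr k r n))"
  have neg: "\<exists>n\<ge>1. (\<Sum>r = 1..l. a r * Fkr k r n) < 0" if a: "a \<in> Rl l" "a \<noteq> (\<lambda>_. 0)" for a
  proof (rule ccontr)
    assume *: "\<not> (\<exists>n\<ge>1. (\<Sum>r = 1..l. a r * Fkr k r n) < 0)"
    \<comment> \<open>Coefficients 1 to l of this cusp form are the entries of a, so it can vanish
      only if a does.\<close>
    define c where "c = (\<lambda>n. \<Sum>r = 1..l. a r * Fkr k r n)"
    have c_mod: "c \<in> modformR k" unfolding c_def by (intro modformR_sum F_mod) auto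
    have c_nth: "c j = (if j = 0 then 0 else a j)" if "j \<le> l" for j
      using that by (auto simp: c_def F_nth if_distrib cong: if_cong)
    have nonneg: "c n \<ge> 0" for n
      using * c_nth[of 0] by (cases "n = 0") (auto simp: c_def not_less)
    have "c n = 0" for n
      by (rule nonneg_cusp_form_eq_0[of m])
         (use c_mod c_nth[of 0] nonneg in \<open>auto simp: modformR_iff m\<close>)
    then have "a j = 0" for j
      using c_nth[of j] a(1) by (cases "j = 0 \<or> j > l") (auto simp: Rl_def)
    with a(2) show False by auto
  qed
  obtain N0 \<delta> where N0: "N0 \<ge> 1" and \<delta>: "\<delta> > 0" and unif: "\<And>a. a \<in> Rl l \<Longrightarrow> a \<noteq> (\<lambda>_. 0) \<Longrightarrow>
      \<exists>n\<in>{1..N0}. \<forall>r. (\<Sum>r = 1..l. a r * Fkr k r n) \<le> - \<delta> * \<bar>a r\<bar>"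
    using uniform_negativity[of l "Fkr k", OF neg] by blast

  define M where "M = Max ((\<lambda>n. \<bar>Fkr k 0 n\<bar>) ` {1..N0})"
  have M: "\<bar>Fkr k 0 n\<bar> \<le> M" if "n \<in> {1..N0}" for n
    unfolding M_def using that by (intro Max_ge) auto
  have "M \<ge> 0" using M[of 1] N0 by simp
  \<comment> \<open>At the index supplied by the uniform margin, 0 <= G a n <= M - \<delta> |a
    r|.\<close>
  define B where "B = M / \<delta>"
  have bound: "\<bar>a r\<bar> \<le> B" if a: "a \<in> Rl l" "\<And>n. n \<in> {1..N0} \<Longrightarrow> G a n \<ge> 0" for a r
  proof (cases "a = (\<lambda>_. 0)")
    case True
    then show ?thesis using \<open>M \<ge> 0\<close> \<delta> by (simp add: B_def)
  next
    case False
    then obtain n where n: "n \<in> {1..N0}" "(\<Sum>r = 1..l. a r * Fkr k r n) \<le> - \<delta> * \<bar>a r\<bar>"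
      using unif a(1) by blast
    then have "\<delta> * \<bar>a r\<bar> \<le> M" using a(2)[OF n(1)] M[OF n(1)] by (simp add: G_def)
    then show ?thesis using \<delta> by (simp add: B_def field_simps)
  qed

  obtain e \<gamma> where e: "e \<in> modformR k" "e 0 = 1" "\<gamma> > 0" "\<And>n. e n \<ge> \<gamma> * real n ^ (3 * m)"
    using modformR_dominating[of m] \<open>m \<ge> 3\<close> unfolding m by auto
  have "\<exists>C. \<forall>n\<ge>1. \<bar>Fkr k r n\<bar> \<le> C * real n ^ (2 * m)" if "r \<in> {1..l}" for r
  proof -
    have "modular_fps (4 * m) (Abs_fps (\<lambda>n. complex_of_real (Fkr k r n)))"
      "fps_nth (Abs_fps (\<lambda>n. complex_of_real (Fkr k r n))) 0 = 0"
      using F_mod[of r] F_nth[of 0 r] that by (simp_all add: modformR_iff m)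
    then obtain C where "\<And>n. n \<ge> 1 \<Longrightarrow> norm (fps_nth (Abs_fps (\<lambda>n. complex_of_real (Fkr k r n))) n) \<le> C * real n ^ (2 * m)"
      by (rule Hecke_bound) auto
    then show ?thesis by auto
  qed
  then obtain C where C: "\<And>r n. r \<in> {1..l} \<Longrightarrow> n \<ge> 1 \<Longrightarrow> \<bar>Fkr k r n\<bar> \<le> C r * real n ^ (2 * m)"
    by metis
  \<comment> \<open>\<open>G a\<close> and \<open>e\<close> share the constant term 1; their
    difference is a combination of cusp forms with coefficients at most B + |e r|.\<close>
  define D where "D = (\<Sum>r = 1..l. (B + \<bar>e r\<bar>) * C r)"
  \<comment> \<open>For n >= D / \<gamma>, using n <= n^m, the growth \<gamma> n^(3m) is at least D
    n^(2m). Taking N >= N0 keeps the bound B available.\<close>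
  define N where "N = max N0 (nat \<lceil>D / \<gamma>\<rceil>)"
  have N: "N \<ge> 1" "N \<ge> N0" using N0 by (auto simp: N_def)
  have tail: "G a n \<ge> 0" if a: "a \<in> Rl l" "\<And>n. n \<in> {1..N} \<Longrightarrow> G a n \<ge> 0" and n: "n > N" for a n
  proof -
    have n1: "n \<ge> 1" using n by simp
    have aB: "\<bar>a r\<bar> \<le> B" for r using bound[OF a(1), of r] a(2) N by simp
    have "G a n - e n = (\<Sum>r = 1..l. (a r - e r) * Fkr k r n)"
      using expand[OF e(1), of n] e(2) by (simp add: G_def left_diff_distrib sum_subtractf)
    also have "\<bar>\<dots>\<bar> \<le> (\<Sum>r = 1..l. \<bar>(a r - e r) * Fkr k r n\<bar>)" by (rule sum_abs)
    also have "\<dots> \<le> (\<Sum>r = 1..l. (B + \<bar>e r\<bar>) * (C r * real n ^ (2 * m)))"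
    proof (rule sum_mono)
      fix r assume r: "r \<in> {1..l}"
      have "\<bar>a r - e r\<bar> \<le> B + \<bar>e r\<bar>" using aB[of r] by linarith
      then show "\<bar>(a r - e r) * Fkr k r n\<bar> \<le> (B + \<bar>e r\<bar>) * (C r * real n ^ (2 * m))"
        unfolding abs_mult using C[OF r n1] by (intro mult_mono) auto
    qed
    also have "\<dots> = D * real n ^ (2 * m)"
      by (simp add: D_def sum_distrib_right mult.assoc)
    finally have 1: "G a n \<ge> e n - D * real n ^ (2 * m)" by linarith
    have "D / \<gamma> \<le> real n" using n unfolding N_def by linarith
    also have "real n \<le> real n ^ m" using n1 \<open>m \<ge> 3\<close> by (intro self_le_power) auto
    finally have "D \<le> \<gamma> * real n ^ m" using e(3) by (simp add: field_simps)
    then have "D * real n ^ (2 * m) \<le> \<gamma> * real n ^ m * real n ^ (2 * m)" by (rule mult_right_mono) simp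
    also have "\<dots> = \<gamma> * real n ^ (3 * m)" by (simp add: power_add [symmetric])
    finally show ?thesis using 1 e(4)[of n] by linarith
  qed
  have all: "G a n \<ge> 0" if "a \<in> Rl l" "\<And>n. n \<in> {1..N} \<Longrightarrow> G a n \<ge> 0" "n \<ge> 1" for a n
    using tail[OF that(1,2), of n] that(2)[of n] that(3) by (cases "n > N") auto
  have Sn: "a \<in> Sn k n \<longleftrightarrow> a \<in> Rl l \<and> G a n \<ge> 0" for a n
    by (simp add: Sn_def kl G_def)
  have Sset: "a \<in> Sset k \<longleftrightarrow> a \<in> Rl l \<and> (\<forall>n\<ge>1. G a n \<ge> 0)" for a
    by (auto simp: Sset_def Sn kl)

  \<comment> \<open>Points of \<open>Rl l\<close> must vanish outside {1..l}, so the coefficient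
    sequence of a form is truncated.\<close>
  define restr where "restr = (\<lambda>c r. if r \<in> {1..l} then c r else 0 :: real)"
  have restr_Rl: "restr c \<in> Rl l" for c by (auto simp: restr_def Rl_def)
  have restr_sum: "(\<Sum>r = 1..l. restr c r * Fkr k r n) = (\<Sum>r = 1..l. c r * Fkr k r n)" for c n
    by (intro sum.cong) (auto simp: restr_def)
  \<comment> \<open>A positive constant term is scaled to 1; the bound on A(k) needs this for forms
    that are not normalised.\<close>
  have form: "c n \<ge> 0" if c: "c \<in> modformR k" "c 0 > 0" "\<And>n. n \<in> {1..N} \<Longrightarrow> c n \<ge> 0" for c n
  proof (cases "n = 0")
    case False
    define a where "a = restr (\<lambda>r. c r / c 0)"
    have G: "G a n = c n / c 0" for n
    proof -
      have "c n / c 0 = Fkr k 0 n + (\<Sum>r = 1..l. c r * Fkr k r n) / c 0"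
        using expand[OF c(1), of n] c(2) by (simp add: add_divide_distrib)
      then show ?thesis unfolding a_def G_def restr_sum by (simp add: sum_divide_distrib)
    qed
    have "G a n \<ge> 0"
    proof (rule all)
      show "a \<in> Rl l" unfolding a_def by (rule restr_Rl)
      show "G a i \<ge> 0" if "i \<in> {1..N}" for i using c(2) c(3)[OF that] by (simp add: G)
      show "n \<ge> 1" using False by simp
    qed
    then show ?thesis using c(2) by (simp add: G zero_le_divide_iff)
  qed (use c in auto)
  \<comment> \<open>Without a constant term nothing offsets the negative margin, so any nonzero
    coordinate would show up as a negative coefficient in {1..N0}.\<close>
  have cusp: "c n = 0" if c: "c \<in> modformR k" "c 0 = 0" "\<And>n. n \<in> {1..N} \<Longrightarrow> c n \<ge> 0" for c n
  proof -
    have c_eq: "c n = (\<Sum>r = 1..l. restr c r * Fkr k r n)" for n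
      unfolding restr_sum using expand[OF c(1), of n] c(2) by simp
    have "restr c = (\<lambda>_. 0)"
    proof (rule ccontr)
      assume nz: "restr c \<noteq> (\<lambda>_. 0)"
      then obtain r where r: "restr c r \<noteq> 0" by auto
      obtain n where n: "n \<in> {1..N0}" "c n \<le> - \<delta> * \<bar>restr c r\<bar>"
        using unif[OF restr_Rl nz] c_eq by auto
      then have "c n < 0" using r \<delta> by (auto intro: le_less_trans simp: mult_pos_pos)
      moreover have "c n \<ge> 0" using c(3)[of n] n(1) N by auto
      ultimately show False by simp
    qed
    then show ?thesis using c_eq[of n] by simp
  qed

  show ?thesis
  proof (intro conjI exI[of _ B] exI[of _ "{1..N}"] ballI allI impI)
    fix a r assume "a \<in> Sset k"
    then show "\<bar>a r\<bar> \<le> B" unfolding Sset by (intro bound) auto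
  next
    show "Sset k = (\<Inter>n \<in> {1..N}. Sn k n)"
    proof (intro equalityI subsetI)
      fix a assume "a \<in> Sset k"
      then show "a \<in> (\<Inter>n \<in> {1..N}. Sn k n)" by (auto simp: Sset Sn)
    next
      fix a assume "a \<in> (\<Inter>n \<in> {1..N}. Sn k n)"
      then have "a \<in> Rl l" "\<And>n. n \<in> {1..N} \<Longrightarrow> G a n \<ge> 0" using N(1) by (auto simp: Sn)
      then show "a \<in> Sset k" unfolding Sset using all by blast
    qed
  next
    fix c assume "c \<in> modformR k" "c 0 = 1"
    then show "(\<forall>n. c n \<ge> 0) \<longleftrightarrow> (\<forall>n \<in> {1..N}. c n \<ge> 0)" using form[of c] by auto
  next
    have "Nf c \<le> enat N" if c: "c \<in> modformR k" "Nf c \<noteq> \<infinity>" for c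
    proof -
      have ex: "\<exists>r. c r < 0" using c(2) by (auto simp: Nf_def split: if_splits)
      have "(LEAST r. c r < 0) \<le> N"
      proof (rule ccontr)
        assume "\<not> ?thesis"
        \<comment> \<open>Index 0 is included, so the constant term is 0 or positive, and
          \<open>cusp\<close> or \<open>form\<close> excludes every negative coefficient.\<close>
        then have nonneg: "c r \<ge> 0" if "r \<le> N" for r
          using that not_less_Least[of r "\<lambda>r. c r < 0"] by (meson le_less_trans not_le)
        show False
        proof (cases "c 0 = 0")
          case True
          have "c i = 0" for i by (rule cusp[OF c(1) True]) (use nonneg in auto)
          with ex show False by simp
        next
          case False
          then have pos: "c 0 > 0" using nonneg[of 0] by simp
          have "c i \<ge> 0" for i by (rule form[OF c(1) pos]) (use nonneg in auto)
          with ex show False by (simp add: not_less [symmetric])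
        qed
      qed
      then show ?thesis using ex by (simp add: Nf_def)
    qed
    moreover have "Max {1..N} = N" using N(1) by (intro Max_eqI) auto
    ultimately show "Ak k \<le> enat (Max {1..N})" unfolding Ak_def by (intro Sup_least) auto
  qed auto
qed

end
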